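(* Let $(k,\ell)$ be a complete Pick pair of kernels on a set $X$. If $Y\subseteq X$ is finite (and non-empty), then $(k,\ell^Y)$ is also a complete Pick pair and, consequently, there exists a kernel $g_Y$ on $X$ such that $$\ell^Y=k\,g_Y.$$
   Context: A kernel on a non-empty set $X$ is a function $k:X\times X\to\mathbb{C}$ such that $[k(z_i,z_j)]_{i,j=1}^n$ is positive semi-definite for all finite choices of points; $\mathcal{H}_k$ is the reproducing kernel Hilbert space. Standing assumption: the given kernels $k$ and $\ell$ do not vanish along the diagonal ($k(x,x)\neq0\neq\ell(x,x)$ for all $x\in X$); this is not required of $\ell^Y$ or $g_Y$. For a non-empty $Y\subseteq X$, $\ell^Y$ denotes the reproducing kernel of the subspace $\{f\in\mathcal{H}_\ell:f(w)=0\text{ for all }w\in Y\}$ of $\mathcal{H}_\ell$. $\mathrm{Mult}(\mathcal{H}_k\otimes\mathbb{C}^N,\mathcal{H}_\ell\otimes\mathbb{C}^N)$ is the set of $\Phi:X\to\mathbb{M}_N$ (complex $N\times N$ matrices) with $\Phi f\in\mathcal{H}_\ell\otimes\mathbb{C}^N$ for all $f\in\mathcal{H}_k\otimes\mathbb{C}^N$, normed by the operator norm of $f\mapsto\Phi f$. $(k,\ell)$ is a complete Pick pair on $X$ if for all $n,N\ge1$, all $z_1,\dots,z_n\in X$ and all $W_1,\dots,W_n\in\mathbb{M}_N$ with $[\ell(z_i,z_j)I_{N\times N}-k(z_i,z_j)W_iW_j^*]_{i,j=1}^n$ positive semi-definite, there is $\Phi\in\mathrm{Mult}(\mathcal{H}_k\otimes\mathbb{C}^N,\mathcal{H}_\ell\otimes\mathbb{C}^N)$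 of norm at most one with $\Phi(z_i)=W_i$ for all $i$. *)

theory Defs
  imports
    "Jordan_Normal_Form.Schur_Decomposition"
    "HOL-Library.Extended_Nonnegative_Real"
begin

text \<open>The underlying non-empty set \<open>X\<close> is the universe of the type variable \<open>'a\<close>.\<close>

section \<open>Positive semi-definite matrices and kernels\<close>

text \<open>On \<open>complex\<close>, \<open>0 \<le> z\<close> means that \<open>z\<close> is real and non-negative.\<close>

definition pos_semidef :: "complex mat \<Rightarrow> bool" where
  "pos_semidef A \<longleftrightarrow> dim_row A = dim_col A \<and>
     (\<forall>v \<in> carrier_vec (dim_row A). 0 \<le> (A *\<^sub>v v) \<bullet>c v)"

definition is_kernel :: "('a \<Rightarrow> 'a \<Rightarrow> complex) \<Rightarrow> bool" where
  "is_kernel k \<longleftrightarrow>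
     (\<forall>n (z :: nat \<Rightarrow> 'a). pos_semidef (mat n n (\<lambda>(i, j). k (z i) (z j))))"

text \<open>The \<open>nN \<times> nN\<close> matrix \<open>[B i j]\<close>, \<open>i, j < n\<close>, with \<open>N \<times> N\<close> blocks \<open>B i j\<close>.\<close>

definition block_mat :: "nat \<Rightarrow> nat \<Rightarrow> (nat \<Rightarrow> nat \<Rightarrow> complex mat) \<Rightarrow> complex mat" where
  "block_mat n N B =
     mat (n * N) (n * N) (\<lambda>(r, s). B (r div N) (s div N) $$ (r mod N, s mod N))"

section \<open>Reproducing kernel Hilbert spaces\<close>

text \<open>A space of functions together with an inner product, linear in the first argument.
  The values of \<open>inner_prod\<close> outside \<open>funs\<close> are irrelevant.\<close>

record 'a fun_space =
  funs :: "('a \<Rightarrow> complex) set"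
  inner_prod :: "('a \<Rightarrow> complex) \<Rightarrow> ('a \<Rightarrow> complex) \<Rightarrow> complex"

definition fnorm :: "'a fun_space \<Rightarrow> ('a \<Rightarrow> complex) \<Rightarrow> real" where
  "fnorm H f = sqrt (Re (inner_prod H f f))"

definition hilbert_fun_space :: "'a fun_space \<Rightarrow> bool" where
  "hilbert_fun_space H \<longleftrightarrow>
     (\<lambda>x. 0) \<in> funs H \<and>
     (\<forall>f \<in> funs H. \<forall>g \<in> funs H. (\<lambda>x. f x + g x) \<in> funs H) \<and>
     (\<forall>c. \<forall>f \<in> funs H. (\<lambda>x. c * f x) \<in> funs H) \<and>
     (\<forall>f \<in> funs H. \<forall>g \<in> funs H. \<forall>h \<in> funs H.
        inner_prod H (\<lambda>x. f x + g x) h = inner_prod H f h + inner_prod H g h) \<and>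
     (\<forall>c. \<forall>f \<in> funs H. \<forall>g \<in> funs H.
        inner_prod H (\<lambda>x. c * f x) g = c * inner_prod H f g) \<and>
     (\<forall>f \<in> funs H. \<forall>g \<in> funs H. inner_prod H g f = cnj (inner_prod H f g)) \<and>
     (\<forall>f \<in> funs H. 0 \<le> inner_prod H f f) \<and>
     (\<forall>f \<in> funs H. inner_prod H f f = 0 \<longrightarrow> f = (\<lambda>x. 0)) \<and>
     (\<forall>s :: nat \<Rightarrow> 'a \<Rightarrow> complex. (\<forall>n. s n \<in> funs H) \<longrightarrow>
        (\<forall>e > 0. \<exists>M. \<forall>m \<ge> M. \<forall>n \<ge> M. fnorm H (\<lambda>x. s m x - s n x) < e) \<longrightarrow>
        (\<exists>f \<in> funs H. (\<lambda>n. fnorm H (\<lambda>x. s n x - f x)) \<longlonglongrightarrow> 0))"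

definition reproducing_kernel :: "'a fun_space \<Rightarrow> ('a \<Rightarrow> 'a \<Rightarrow> complex) \<Rightarrow> bool" where
  "reproducing_kernel H k \<longleftrightarrow>
     (\<forall>x. (\<lambda>y. k y x) \<in> funs H \<and> (\<forall>f \<in> funs H. inner_prod H f (\<lambda>y. k y x) = f x))"

text \<open>By the Moore--Aronszajn theorem every kernel \<open>k\<close> has such a space, and its functions and
  the inner product on them are determined by \<open>k\<close>; the choice only affects the irrelevant values
  of \<open>inner_prod\<close>.\<close>

definition rkhs :: "('a \<Rightarrow> 'a \<Rightarrow> complex) \<Rightarrow> 'a fun_space" where
  "rkhs k = (SOME H. hilbert_fun_space H \<and> reproducing_kernel H k)"

definition vanishing_subspace :: "'a fun_space \<Rightarrow> 'a set \<Rightarrow> 'a fun_space" where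
  "vanishing_subspace H Y = H \<lparr>funs := {f \<in> funs H. \<forall>w \<in> Y. f w = 0}\<rparr>"

text \<open>The kernel written \<open>\<ell>\<close> with superscript \<open>Y\<close> in the literature.\<close>

definition vanishing_kernel ::
  "('a \<Rightarrow> 'a \<Rightarrow> complex) \<Rightarrow> 'a set \<Rightarrow> 'a \<Rightarrow> 'a \<Rightarrow> complex" where
  "vanishing_kernel l Y = (THE K. reproducing_kernel (vanishing_subspace (rkhs l) Y) K)"

section \<open>Multipliers\<close>

text \<open>The tensor product of \<open>H\<close> with \<open>\<complex>\<close>-\<open>N\<close>-space, as usual identified with the space of
  vector-valued functions all of whose components lie in \<open>H\<close>, and its norm.\<close>

definition tensor_funs :: "'a fun_space \<Rightarrow> nat \<Rightarrow> ('a \<Rightarrow> complex vec) set" where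
  "tensor_funs H N =
     {F. (\<forall>x. F x \<in> carrier_vec N) \<and> (\<forall>i < N. (\<lambda>x. F x $ i) \<in> funs H)}"

definition tensor_norm :: "'a fun_space \<Rightarrow> nat \<Rightarrow> ('a \<Rightarrow> complex vec) \<Rightarrow> real" where
  "tensor_norm H N F = sqrt (\<Sum>i < N. (fnorm H (\<lambda>x. F x $ i))\<^sup>2)"

definition Mult ::
  "('a \<Rightarrow> 'a \<Rightarrow> complex) \<Rightarrow> ('a \<Rightarrow> 'a \<Rightarrow> complex) \<Rightarrow> nat \<Rightarrow> ('a \<Rightarrow> complex mat) set" where
  "Mult k l N =
     {\<Phi>. (\<forall>x. \<Phi> x \<in> carrier_mat N N) \<and>
         (\<forall>F \<in> tensor_funs (rkhs k) N. (\<lambda>x. \<Phi> x *\<^sub>v F x) \<in> tensor_funs (rkhs l) N)}"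

text \<open>The operator norm of \<open>F \<mapsto> \<Phi> F\<close>; it is taken in \<open>ennreal\<close> so that the supremum is
  meaningful without knowing beforehand that the operator is bounded.\<close>

definition mult_norm ::
  "('a \<Rightarrow> 'a \<Rightarrow> complex) \<Rightarrow> ('a \<Rightarrow> 'a \<Rightarrow> complex) \<Rightarrow> nat \<Rightarrow> ('a \<Rightarrow> complex mat) \<Rightarrow> ennreal" where
  "mult_norm k l N \<Phi> =
     (SUP F \<in> {F \<in> tensor_funs (rkhs k) N. tensor_norm (rkhs k) N F \<le> 1}.
        ennreal (tensor_norm (rkhs l) N (\<lambda>x. \<Phi> x *\<^sub>v F x)))"

definition complete_Pick_pair ::
  "('a \<Rightarrow> 'a \<Rightarrow> complex) \<Rightarrow> ('a \<Rightarrow> 'a \<Rightarrow> complex) \<Rightarrow> bool" where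
  "complete_Pick_pair k l \<longleftrightarrow> is_kernel k \<and> is_kernel l \<and>
     (\<forall>n \<ge> 1. \<forall>N \<ge> 1. \<forall>(z :: nat \<Rightarrow> 'a) (W :: nat \<Rightarrow> complex mat).
        (\<forall>i < n. W i \<in> carrier_mat N N) \<longrightarrow>
        pos_semidef (block_mat n N (\<lambda>i j.
          l (z i) (z j) \<cdot>\<^sub>m 1\<^sub>m N - k (z i) (z j) \<cdot>\<^sub>m (W i * mat_adjoint (W j)))) \<longrightarrow>
        (\<exists>\<Phi> \<in> Mult k l N. mult_norm k l N \<Phi> \<le> 1 \<and> (\<forall>i < n. \<Phi> (z i) = W i)))"

end

theory Submission
  imports Defs "HOL-Analysis.Function_Topology"
begin

text \<open>Write \<open>L\<close> for \<open>vanishing_kernel l Y\<close>. Its space is the subspace of \<open>rkhs l\<close> of functions that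
  vanish on \<open>Y\<close>, and \<open>l - L\<close> is a positive kernel. Given a Pick problem for \<open>(k, L)\<close>, prescribe
  in addition the value \<open>0\<close> at the points of \<open>Y\<close>. As \<open>L\<close> vanishes there, the Pick matrix for \<open>(k, l)\<close>
  of the enlarged problem is the given one, padded with zeros, plus copies of the matrix of
  \<open>l - L\<close>, so it is positive (\<open>extended_pick_form_nonneg\<close>). A contractive solution maps into
  functions vanishing on \<open>Y\<close>, hence solves the original problem
  (\<open>complete_Pick_pair_vanishing_kernel\<close>).

  For the factorization let \<open>(k, m)\<close> be any complete Pick pair with \<open>k x x \<noteq> 0\<close>. Suppose that
  \<open>m x y = k x y * (w x \<bullet> w y)\<close> on a finite set \<open>F\<close>, with vectors \<open>w x\<close>. Solving the Pick problem for
  the matrices with first row \<open>w x\<close> and other rows zero extends \<open>w\<close> to a function \<open>\<phi>\<close> on the whole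
  set for which the defect \<open>m x y - k x y * (\<phi> x \<bullet> \<phi> y)\<close> is positive
  (\<open>extend_factorization\<close>, \<open>contractive_row_kernel\<close>). The defect is zero on \<open>F\<close>, so on \<open>F\<close> together
  with one more point \<open>a\<close> it is concentrated at \<open>(a, a)\<close>, where one more coordinate of the vectors
  absorbs it (\<open>finite_factorization\<close>). Tychonoff's theorem passes from finite sets to the whole set
  (\<open>complete_Pick_pair_factorization\<close>).

  All this needs the Moore--Aronszajn theorem, in two roles: it gives the spaces \<open>rkhs k\<close> their
  meaning, and it identifies the space chosen for \<open>L\<close> with the subspace of the one chosen for \<open>l\<close>.
  Both follow from a description of the functions and their norms by \<open>k\<close> alone, as suprema over
  finite combinations of kernel functions (\<open>moore_aronszajn\<close>, \<open>rkhs_vanishing_kernel\<close>).\<close>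

section \<open>Kernels and their quadratic forms\<close>

text \<open>A finite combination of point evaluations is encoded as a list of coefficient-point
  pairs, so that sums of combinations are concatenations and no support has to be tracked.\<close>

type_synonym 'a comb = "(complex \<times> 'a) list"

definition lincomb :: "('a \<Rightarrow> 'a \<Rightarrow> complex) \<Rightarrow> 'a comb \<Rightarrow> 'a \<Rightarrow> complex" where
  "lincomb k cs = (\<lambda>x. \<Sum>(c, y)\<leftarrow>cs. c * k x y)"

text \<open>If \<open>f\<close> belongs to a space with reproducing kernel \<open>k\<close>, this is the inner product of \<open>f\<close>
  with \<open>lincomb k cs\<close>; the formula makes sense for every function \<open>f\<close>.\<close>

definition pairing :: "('a \<Rightarrow> complex) \<Rightarrow> 'a comb \<Rightarrow> complex" where
  "pairing f cs = (\<Sum>(c, y)\<leftarrow>cs. cnj c * f y)"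

definition scale :: "complex \<Rightarrow> 'a comb \<Rightarrow> 'a comb" where
  "scale a cs = map (\<lambda>(c, y). (a * c, y)) cs"

definition qform :: "('a \<Rightarrow> 'a \<Rightarrow> complex) \<Rightarrow> 'a comb \<Rightarrow> real" where
  "qform k cs = Re (pairing (lincomb k cs) cs)"

lemma lincomb_Nil [simp]: "lincomb k [] = (\<lambda>x. 0)"
  by (simp add: lincomb_def)

lemma lincomb_Cons [simp]: "lincomb k ((c, y) # cs) = (\<lambda>x. c * k x y + lincomb k cs x)"
  by (simp add: lincomb_def)

lemma lincomb_append [simp]: "lincomb k (cs @ ds) = (\<lambda>x. lincomb k cs x + lincomb k ds x)"
  by (simp add: lincomb_def)

lemma lincomb_scale [simp]: "lincomb k (scale a cs) = (\<lambda>x. a * lincomb k cs x)"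
  by (induction cs) (auto simp: scale_def lincomb_def algebra_simps fun_eq_iff)

lemma pairing_Nil [simp]: "pairing f [] = 0"
  by (simp add: pairing_def)

lemma pairing_Cons [simp]: "pairing f ((c, y) # cs) = cnj c * f y + pairing f cs"
  by (simp add: pairing_def)

lemma pairing_append [simp]: "pairing f (cs @ ds) = pairing f cs + pairing f ds"
  by (simp add: pairing_def)

lemma pairing_scale [simp]: "pairing f (scale a cs) = cnj a * pairing f cs"
  by (induction cs) (auto simp: scale_def pairing_def algebra_simps)

lemma pairing_add [simp]: "pairing (\<lambda>x. f x + g x) cs = pairing f cs + pairing g cs"
  by (induction cs) (auto simp: pairing_def algebra_simps)

lemma pairing_diff [simp]: "pairing (\<lambda>x. f x - g x) cs = pairing f cs - pairing g cs"
  by (induction cs) (auto simp: pairing_def algebra_simps)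

lemma pairing_cmult [simp]: "pairing (\<lambda>x. a * f x) cs = a * pairing f cs"
  by (induction cs) (auto simp: pairing_def algebra_simps)

lemma pairing_zero [simp]: "pairing (\<lambda>x. 0) cs = 0"
  by (induction cs) auto

lemma lincomb_kernel_diff: "lincomb (\<lambda>x y. k x y - l x y) cs = (\<lambda>x. lincomb k cs x - lincomb l cs x)"
  by (induction cs) (auto simp: algebra_simps fun_eq_iff)

lemma tendsto_pairing:
  assumes "\<And>x. (\<lambda>n. s n x) \<longlonglongrightarrow> f x"
  shows "(\<lambda>n. pairing (s n) cs) \<longlonglongrightarrow> pairing f cs"
proof (induction cs)
  case (Cons a cs)
  then show ?case
    by (cases a) (auto intro!: tendsto_intros assms)
qed simp

lemma pairing_sum: "pairing (\<lambda>x. \<Sum>p\<in>P. f p x) cs = (\<Sum>p\<in>P. pairing (f p) cs)"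
proof (induction cs)
  case (Cons a cs)
  then show ?case
    by (cases a) (auto simp: sum.distrib sum_distrib_left)
qed simp

lemma pairing_upt:
  "pairing f (map (\<lambda>i. (v i, z i)) [0..<n]) = (\<Sum>i<n. cnj (v i) * f (z i))"
  by (induction n) auto

lemma lincomb_upt:
  "lincomb k (map (\<lambda>i. (v i, z i)) [0..<n]) x = (\<Sum>i<n. v i * k x (z i))"
  by (induction n) auto

lemma comb_conv_upt:
  "cs = map (\<lambda>i. (fst (cs ! i), snd (cs ! i))) [0..<length cs]"
  by (simp add: map_nth)

lemma pos_semidef_mat_iff:
  "pos_semidef (mat n n A) \<longleftrightarrow>
     (\<forall>v :: nat \<Rightarrow> complex. 0 \<le> (\<Sum>i<n. \<Sum>j<n. A (i, j) * v j * cnj (v i)))"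
proof -
  have form: "(mat n n A *\<^sub>v w) \<bullet>c w = (\<Sum>i<n. \<Sum>j<n. A (i, j) * w $ j * cnj (w $ i))"
    if "w \<in> carrier_vec n" for w
    using that
    by (auto simp: scalar_prod_def sum_distrib_right atLeast0LessThan intro!: sum.cong)
  show ?thesis
  proof
    assume psd: "pos_semidef (mat n n A)"
    show "\<forall>v :: nat \<Rightarrow> complex. 0 \<le> (\<Sum>i<n. \<Sum>j<n. A (i, j) * v j * cnj (v i))"
    proof
      fix v :: "nat \<Rightarrow> complex"
      have "0 \<le> (mat n n A *\<^sub>v vec n v) \<bullet>c vec n v"
        using psd by (auto simp: pos_semidef_def)
      also have "\<dots> = (\<Sum>i<n. \<Sum>j<n. A (i, j) * v j * cnj (v i))"
        by (subst form) (auto intro!: sum.cong)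
      finally show "0 \<le> (\<Sum>i<n. \<Sum>j<n. A (i, j) * v j * cnj (v i))" .
    qed
  next
    assume "\<forall>v :: nat \<Rightarrow> complex. 0 \<le> (\<Sum>i<n. \<Sum>j<n. A (i, j) * v j * cnj (v i))"
    then show "pos_semidef (mat n n A)"
      by (auto simp: pos_semidef_def form)
  qed
qed

lemma is_kernel_iff: "is_kernel k \<longleftrightarrow> (\<forall>cs. 0 \<le> pairing (lincomb k cs) cs)"
proof -
  have sums: "(\<Sum>i<n. \<Sum>j<n. k (z i) (z j) * v j * cnj (v i)) =
      pairing (lincomb k (map (\<lambda>i. (v i, z i)) [0..<n])) (map (\<lambda>i. (v i, z i)) [0..<n])"
    for n and z :: "nat \<Rightarrow> 'a" and v
    by (simp add: pairing_upt lincomb_upt sum_distrib_left mult_ac)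
  show ?thesis
  proof
    assume k: "is_kernel k"
    show "\<forall>cs. 0 \<le> pairing (lincomb k cs) cs"
    proof
      fix cs
      have "0 \<le> (\<Sum>i<n. \<Sum>j<n. k (z i) (z j) * v j * cnj (v i))"
        for n and z :: "nat \<Rightarrow> 'a" and v
        using k by (simp add: is_kernel_def pos_semidef_mat_iff)
      then show "0 \<le> pairing (lincomb k cs) cs"
        unfolding sums by (subst (1 2) comb_conv_upt)
    qed
  next
    assume "\<forall>cs. 0 \<le> pairing (lincomb k cs) cs"
    then show "is_kernel k"
      by (simp add: is_kernel_def pos_semidef_mat_iff sums)
  qed
qed

lemma of_real_cmod_square: "(complex_of_real (cmod z))\<^sup>2 = z * cnj z"
  using complex_norm_square[of z] by simp

lemma Re_of_real_mult: "Re (complex_of_real r * z) = r * Re z"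
  by simp

locale psd_kernel =
  fixes k :: "'a \<Rightarrow> 'a \<Rightarrow> complex"
  assumes kernel: "is_kernel k"
begin

lemma pairing_nonneg: "0 \<le> pairing (lincomb k cs) cs"
  using kernel by (simp add: is_kernel_iff)

lemma pairing_self: "pairing (lincomb k cs) cs = of_real (qform k cs)"
  using pairing_nonneg[of cs] by (simp add: qform_def complex_eq_iff less_eq_complex_def)

lemma qform_nonneg: "0 \<le> qform k cs"
  using pairing_nonneg[of cs] by (simp add: qform_def less_eq_complex_def)

lemma diag_nonneg: "0 \<le> k x x"
  using pairing_nonneg[of "[(1, x)]"] by simp

lemma hermitian: "k y x = cnj (k x y)"
proof -
  have "Im (k x x) = 0" for x
    using diag_nonneg[of x] by (simp add: less_eq_complex_def)
  moreover have "Im (pairing (lincomb k [(1, x), (1, y)]) [(1, x), (1, y)]) = 0"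
    "Im (pairing (lincomb k [(1, x), (\<i>, y)]) [(1, x), (\<i>, y)]) = 0"
    using pairing_nonneg by (auto simp: less_eq_complex_def simp del: lincomb_Cons pairing_Cons)
  ultimately show ?thesis
    by (auto simp: complex_eq_iff algebra_simps)
qed

lemma pairing_kernel: "pairing (\<lambda>x. k x y) cs = cnj (lincomb k cs y)"
proof (induction cs)
  case (Cons a cs)
  then show ?case
    by (cases a) (auto simp: hermitian[of y])
qed simp

lemma pairing_swap: "pairing (lincomb k cs) ds = cnj (pairing (lincomb k ds) cs)"
proof (induction cs)
  case (Cons a cs)
  then show ?case
    by (cases a) (auto simp: pairing_kernel)
qed simp

lemma qform_append:
  "qform k (cs @ ds) = qform k cs + 2 * Re (pairing (lincomb k cs) ds) + qform k ds"
proof -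
  have "Re (pairing (lincomb k ds) cs) = Re (pairing (lincomb k cs) ds)"
    by (subst pairing_swap) simp
  then show ?thesis
    unfolding qform_def by simp
qed

lemma qform_scale: "qform k (scale a cs) = (cmod a)\<^sup>2 * qform k cs"
proof -
  have "pairing (lincomb k (scale a cs)) (scale a cs) = of_real ((cmod a)\<^sup>2) * pairing (lincomb k cs) cs"
    by (simp add: of_real_cmod_square)
  then show ?thesis
    by (simp only: qform_def Re_of_real_mult)
qed

lemma qform_point: "qform k [(c, x)] = (cmod c)\<^sup>2 * Re (k x x)"
proof -
  have "pairing (lincomb k [(c, x)]) [(c, x)] = of_real ((cmod c)\<^sup>2) * k x x"
    by (simp add: of_real_cmod_square)
  then show ?thesis
    by (simp only: qform_def Re_of_real_mult)
qed

end

section \<open>The Moore--Aronszajn theorem\<close>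

text \<open>In a space with reproducing kernel \<open>k\<close> and norm \<open>norm\<close>, \<open>gain k f cs\<close> is
  \<open>(norm f)\<^sup>2 - (norm (f - lincomb k cs))\<^sup>2\<close>. As the combinations are dense, its supremum over \<open>cs\<close>
  is \<open>(norm f)\<^sup>2\<close>, and the supremum is finite only for members of the space. This describes the
  space and its norm in terms of \<open>k\<close> alone.\<close>

definition gain :: "('a \<Rightarrow> 'a \<Rightarrow> complex) \<Rightarrow> ('a \<Rightarrow> complex) \<Rightarrow> 'a comb \<Rightarrow> real" where
  "gain k f cs = 2 * Re (pairing f cs) - qform k cs"

definition kernel_funs :: "('a \<Rightarrow> 'a \<Rightarrow> complex) \<Rightarrow> ('a \<Rightarrow> complex) set" where
  "kernel_funs k = {f. bdd_above (range (gain k f))}"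

definition sqnorm :: "('a \<Rightarrow> 'a \<Rightarrow> complex) \<Rightarrow> ('a \<Rightarrow> complex) \<Rightarrow> real" where
  "sqnorm k f = (SUP cs. gain k f cs)"

definition approx :: "('a \<Rightarrow> 'a \<Rightarrow> complex) \<Rightarrow> ('a \<Rightarrow> complex) \<Rightarrow> nat \<Rightarrow> 'a comb" where
  "approx k f n = (SOME cs. sqnorm k f - gain k f cs < 1 / real (Suc n))"

text \<open>The combinations \<open>approx k g n\<close> converge to \<open>g\<close> in norm, and the inner product of \<open>f\<close> with a
  combination is its pairing. Hence this is the only possible inner product; in this form it is
  linear in \<open>f\<close> by construction.\<close>

definition kernel_ip ::
  "('a \<Rightarrow> 'a \<Rightarrow> complex) \<Rightarrow> ('a \<Rightarrow> complex) \<Rightarrow> ('a \<Rightarrow> complex) \<Rightarrow> complex" where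
  "kernel_ip k f g = lim (\<lambda>n. pairing f (approx k g n))"

lemma gain_Nil [simp]: "gain k f [] = 0"
  by (simp add: gain_def qform_def)

lemma gain_le_sqnorm: "f \<in> kernel_funs k \<Longrightarrow> gain k f cs \<le> sqnorm k f"
  unfolding kernel_funs_def sqnorm_def by (auto intro: cSUP_upper)

lemma sqnorm_leI:
  assumes "\<And>cs. gain k f cs \<le> B"
  shows "f \<in> kernel_funs k" "sqnorm k f \<le> B"
  using assms unfolding kernel_funs_def sqnorm_def
  by (auto intro!: bdd_aboveI2 cSUP_least)

lemma sqnorm_nonneg: "f \<in> kernel_funs k \<Longrightarrow> 0 \<le> sqnorm k f"
  using gain_le_sqnorm[of f k "[]"] by simp

lemma approx_less:
  assumes "f \<in> kernel_funs k"
  shows "sqnorm k f - gain k f (approx k f n) < 1 / real (Suc n)"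
proof -
  have "\<exists>cs. sqnorm k f - 1 / real (Suc n) < gain k f cs"
    using assms unfolding kernel_funs_def sqnorm_def
    using less_cSUP_iff[of UNIV "gain k f" "Sup (range (gain k f)) - 1 / real (Suc n)"] by simp
  then have "\<exists>cs. sqnorm k f - gain k f cs < 1 / real (Suc n)"
    by (auto simp only: diff_less_eq add.commute)
  from someI_ex[OF this] show ?thesis
    by (simp only: approx_def)
qed

lemma square_tendsto_zeroI:
  fixes u :: "nat \<Rightarrow> complex"
  assumes "\<And>n. (cmod (u n))\<^sup>2 \<le> d n" "d \<longlonglongrightarrow> 0"
  shows "u \<longlonglongrightarrow> 0"
proof -
  have "(\<lambda>n. (cmod (u n))\<^sup>2) \<longlonglongrightarrow> 0"
    by (rule tendsto_sandwich[OF _ _ tendsto_const assms(2)]) (use assms(1) in auto)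
  then have "(\<lambda>n. sqrt ((cmod (u n))\<^sup>2)) \<longlonglongrightarrow> sqrt 0"
    by (rule tendsto_real_sqrt)
  then show ?thesis
    by (simp add: tendsto_norm_zero_iff)
qed

context psd_kernel
begin

lemma gain_scale: "gain k (\<lambda>x. a * f x) (scale a cs) = (cmod a)\<^sup>2 * gain k f cs"
proof -
  have "pairing (\<lambda>x. a * f x) (scale a cs) = of_real ((cmod a)\<^sup>2) * pairing f cs"
    by (simp add: of_real_cmod_square)
  then show ?thesis
    by (simp only: gain_def qform_scale Re_of_real_mult) (simp add: algebra_simps)
qed

lemma kernel_funs_zero: "(\<lambda>x. 0) \<in> kernel_funs k"
  by (rule sqnorm_leI(1)[of _ _ 0]) (simp add: gain_def qform_nonneg)

lemma kernel_funs_scale: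
  assumes "f \<in> kernel_funs k"
  shows "(\<lambda>x. a * f x) \<in> kernel_funs k"
proof (cases "a = 0")
  case False
  have "gain k (\<lambda>x. a * f x) cs \<le> (cmod a)\<^sup>2 * sqnorm k f" for cs
  proof -
    have "scale a (scale (inverse a) cs) = cs"
      using False by (induction cs) (auto simp: scale_def)
    then have "gain k (\<lambda>x. a * f x) cs = (cmod a)\<^sup>2 * gain k f (scale (inverse a) cs)"
      by (metis gain_scale)
    then show ?thesis
      using gain_le_sqnorm[OF assms] by (simp add: mult_left_mono)
  qed
  then show ?thesis
    by (rule sqnorm_leI(1))
qed (simp add: kernel_funs_zero)

text \<open>The gain is affine in the function, and \<open>f + g\<close> is the midpoint of \<open>2 f\<close> and \<open>2 g\<close>.\<close>

lemma kernel_funs_add: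
  assumes "f \<in> kernel_funs k" "g \<in> kernel_funs k"
  shows "(\<lambda>x. f x + g x) \<in> kernel_funs k"
proof -
  have "gain k (\<lambda>x. f x + g x) cs \<le>
      (sqnorm k (\<lambda>x. 2 * f x) + sqnorm k (\<lambda>x. 2 * g x)) / 2" for cs
    using gain_le_sqnorm[OF kernel_funs_scale[OF assms(1), of 2], of cs]
      gain_le_sqnorm[OF kernel_funs_scale[OF assms(2), of 2], of cs]
    by (simp add: gain_def)
  then show ?thesis
    by (rule sqnorm_leI(1))
qed

lemma kernel_funs_diff:
  assumes "f \<in> kernel_funs k" "g \<in> kernel_funs k"
  shows "(\<lambda>x. f x - g x) \<in> kernel_funs k"
  using kernel_funs_add[OF assms(1) kernel_funs_scale[OF assms(2), of "-1"]] by simp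

text \<open>Testing \<open>gain k f\<close> on the multiples of \<open>cs\<close> gives the Cauchy--Schwarz inequality.\<close>

lemma pairing_bound:
  assumes "f \<in> kernel_funs k"
  shows "(cmod (pairing f cs))\<^sup>2 \<le> sqnorm k f * qform k cs"
proof -
  define P where "P = (cmod (pairing f cs))\<^sup>2"
  have test: "2 * t * P - t\<^sup>2 * P * qform k cs \<le> sqnorm k f" for t :: real
  proof -
    let ?ds = "scale (of_real t * pairing f cs) cs"
    have "pairing f ?ds = of_real (t * P)"
      by (simp add: P_def of_real_cmod_square)
    moreover have "qform k ?ds = t\<^sup>2 * P * qform k cs"
      by (simp add: qform_scale P_def norm_mult power_mult_distrib)
    ultimately have "gain k f ?ds = 2 * t * P - t\<^sup>2 * P * qform k cs"
      by (simp only: gain_def Re_complex_of_real mult.assoc)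
    then show ?thesis
      using gain_le_sqnorm[OF assms, of ?ds] by simp
  qed
  have "0 \<le> P"
    by (simp add: P_def)
  \<comment> \<open>The optimal \<open>t\<close> is \<open>1 / qform k cs\<close>; if that does not exist, a large \<open>t\<close> forces \<open>P = 0\<close>.\<close>
  show ?thesis
  proof (cases "qform k cs = 0")
    case True
    have "P = 0"
    proof (rule ccontr)
      assume "P \<noteq> 0"
      then show False
        using test[of "(sqnorm k f + 1) / P"] sqnorm_nonneg[OF assms] True by simp
    qed
    then show ?thesis
      using True by (simp add: P_def)
  next
    case False
    then have pos: "0 < qform k cs"
      using qform_nonneg[of cs] by simp
    have "P / qform k cs \<le> sqnorm k f"
      using test[of "1 / qform k cs"] pos by (simp add: power2_eq_square)
    then show ?thesis
      using pos by (simp add: P_def field_simps)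
  qed
qed

lemma eval_bound: "f \<in> kernel_funs k \<Longrightarrow> (cmod (f x))\<^sup>2 \<le> sqnorm k f * Re (k x x)"
  using pairing_bound[of f "[(1, x)]"] qform_point[of 1 x] by simp

lemma diff_lincomb:
  assumes "f \<in> kernel_funs k"
  shows "(\<lambda>x. f x - lincomb k cs x) \<in> kernel_funs k"
    and "sqnorm k (\<lambda>x. f x - lincomb k cs x) \<le> sqnorm k f - gain k f cs"
proof -
  have "gain k (\<lambda>x. f x - lincomb k cs x) ds \<le> sqnorm k f - gain k f cs" for ds
    using gain_le_sqnorm[OF assms, of "cs @ ds"] by (simp add: gain_def qform_append)
  then show "(\<lambda>x. f x - lincomb k cs x) \<in> kernel_funs k"
    and "sqnorm k (\<lambda>x. f x - lincomb k cs x) \<le> sqnorm k f - gain k f cs"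
    by (rule sqnorm_leI)+
qed

lemma gain_lincomb: "gain k (lincomb k cs) ds = qform k cs - qform k (cs @ scale (-1) ds)"
  by (simp add: gain_def qform_append qform_scale)

lemma lincomb_kernel_funs: "lincomb k cs \<in> kernel_funs k"
  and sqnorm_lincomb: "sqnorm k (lincomb k cs) = qform k cs"
proof -
  have le: "gain k (lincomb k cs) ds \<le> qform k cs" for ds
    using qform_nonneg by (simp add: gain_lincomb)
  show "lincomb k cs \<in> kernel_funs k"
    by (rule sqnorm_leI(1)[OF le])
  from gain_le_sqnorm[OF this, of cs] sqnorm_leI(2)[OF le]
  show "sqnorm k (lincomb k cs) = qform k cs"
    by (simp add: gain_def qform_def)
qed

lemma qform_parallelogram:
  "qform k (cs @ ds) + qform k (cs @ scale (-1) ds) = 2 * qform k cs + 2 * qform k ds"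
  by (simp add: qform_append qform_scale)

text \<open>Near-maximizers of the gain are close to one another: by the parallelogram law their
  midpoint would otherwise gain more than the supremum.\<close>

lemma qform_diff_bound:
  assumes "f \<in> kernel_funs k"
  shows "qform k (cs @ scale (-1) ds) \<le>
    2 * (sqnorm k f - gain k f cs) + 2 * (sqnorm k f - gain k f ds)"
proof -
  have "4 * gain k f (scale (1 / 2) (cs @ ds)) =
      4 * Re (pairing f cs) + 4 * Re (pairing f ds) - qform k (cs @ ds)"
    by (simp add: gain_def qform_scale power_divide)
  moreover have "gain k f (scale (1 / 2) (cs @ ds)) \<le> sqnorm k f"
    by (rule gain_le_sqnorm[OF assms])
  moreover have "gain k f cs = 2 * Re (pairing f cs) - qform k cs"
    "gain k f ds = 2 * Re (pairing f ds) - qform k ds"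
    by (simp_all add: gain_def)
  ultimately show ?thesis
    using qform_parallelogram[of cs ds] unfolding right_diff_distrib by linarith
qed

lemma qform_approx_le:
  assumes "f \<in> kernel_funs k"
  shows "qform k (approx k f n) \<le> 2 + 2 * sqnorm k f"
proof -
  have "sqnorm k f - gain k f (approx k f n) < 1"
    using approx_less[OF assms, of n] by (rule less_le_trans) simp
  then show ?thesis
    using qform_diff_bound[OF assms, of "approx k f n" "[]"] by (simp add: scale_def)
qed

lemma gain_approx_tendsto:
  assumes "f \<in> kernel_funs k"
  shows "(\<lambda>n. sqnorm k f - gain k f (approx k f n)) \<longlonglongrightarrow> 0"
proof (rule tendsto_sandwich[where f = "\<lambda>_. 0" and h = "\<lambda>n. 1 / real (Suc n)"])
  show "(\<lambda>n. 1 / real (Suc n)) \<longlonglongrightarrow> 0"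
    using LIMSEQ_inverse_real_of_nat by (simp add: divide_inverse)
  show "\<forall>\<^sub>F n in sequentially. sqnorm k f - gain k f (approx k f n) \<le> 1 / real (Suc n)"
    using approx_less[OF assms] by (intro always_eventually allI less_imp_le)
  show "\<forall>\<^sub>F n in sequentially. 0 \<le> sqnorm k f - gain k f (approx k f n)"
    using gain_le_sqnorm[OF assms] by (intro always_eventually allI) simp
qed simp

lemma kernel_ip_tendsto:
  assumes f: "f \<in> kernel_funs k" and g: "g \<in> kernel_funs k"
  shows "(\<lambda>n. pairing f (approx k g n)) \<longlonglongrightarrow> kernel_ip k f g"
proof -
  let ?d = "\<lambda>n. sqnorm k g - gain k g (approx k g n)"
  have "Cauchy (\<lambda>n. pairing f (approx k g n))"
  proof (rule metric_CauchyI)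
    fix e :: real
    assume "0 < e"
    define c where "c = 4 * (sqnorm k f + 1)"
    have "0 < c"
      using sqnorm_nonneg[OF f] by (simp add: c_def)
    then have "\<forall>\<^sub>F n in sequentially. ?d n < e\<^sup>2 / c"
      using \<open>0 < e\<close> by (intro order_tendstoD[OF gain_approx_tendsto[OF g]]) simp
    then obtain M where M: "\<And>n. M \<le> n \<Longrightarrow> ?d n < e\<^sup>2 / c"
      by (auto simp: eventually_sequentially)
    show "\<exists>M. \<forall>m\<ge>M. \<forall>n\<ge>M. dist (pairing f (approx k g m)) (pairing f (approx k g n)) < e"
    proof (intro exI[of _ M] allI impI)
      fix m n
      assume mn: "M \<le> m" "M \<le> n"
      let ?cs = "approx k g m @ scale (-1) (approx k g n)"
      have "qform k ?cs \<le> 2 * ?d m + 2 * ?d n"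
        by (rule qform_diff_bound[OF g])
      also have "\<dots> < 4 * (e\<^sup>2 / c)"
        using M[OF mn(1)] M[OF mn(2)] unfolding right_diff_distrib by linarith
      finally have q: "qform k ?cs < 4 * (e\<^sup>2 / c)" .
      have "(cmod (pairing f ?cs))\<^sup>2 \<le> sqnorm k f * qform k ?cs"
        by (rule pairing_bound[OF f])
      also have "\<dots> \<le> (sqnorm k f + 1) * qform k ?cs"
        by (intro mult_right_mono qform_nonneg) simp
      also have "\<dots> < (sqnorm k f + 1) * (4 * (e\<^sup>2 / c))"
        using q sqnorm_nonneg[OF f] by (intro mult_strict_left_mono) auto
      also have "\<dots> = e\<^sup>2"
        using \<open>0 < c\<close> by (simp add: c_def field_simps)
      finally have "cmod (pairing f ?cs) < e"
        using \<open>0 < e\<close> by (simp add: power2_less_imp_less)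
      then show "dist (pairing f (approx k g m)) (pairing f (approx k g n)) < e"
        by (simp add: dist_norm)
    qed
  qed
  then show ?thesis
    unfolding kernel_ip_def by (simp add: Cauchy_convergent_iff convergent_LIMSEQ_iff)
qed

lemma kernel_ip_eqI:
  "f \<in> kernel_funs k \<Longrightarrow> g \<in> kernel_funs k \<Longrightarrow>
    (\<lambda>n. pairing f (approx k g n)) \<longlonglongrightarrow> c \<Longrightarrow> kernel_ip k f g = c"
  using kernel_ip_tendsto LIMSEQ_unique by blast

text \<open>In this form of the limit both arguments are combinations, which makes it symmetric.\<close>

lemma kernel_ip_tendsto_approx:
  assumes f: "f \<in> kernel_funs k" and g: "g \<in> kernel_funs k"
  shows "(\<lambda>n. pairing (lincomb k (approx k f n)) (approx k g n)) \<longlonglongrightarrow> kernel_ip k f g"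
proof -
  have "(\<lambda>n. pairing (\<lambda>x. f x - lincomb k (approx k f n) x) (approx k g n)) \<longlonglongrightarrow> 0"
  proof (rule square_tendsto_zeroI)
    fix n
    have "(cmod (pairing (\<lambda>x. f x - lincomb k (approx k f n) x) (approx k g n)))\<^sup>2 \<le>
        sqnorm k (\<lambda>x. f x - lincomb k (approx k f n) x) * qform k (approx k g n)"
      by (rule pairing_bound[OF diff_lincomb(1)[OF f]])
    also have "\<dots> \<le> (sqnorm k f - gain k f (approx k f n)) * (2 + 2 * sqnorm k g)"
      using diff_lincomb(2)[OF f] qform_approx_le[OF g] gain_le_sqnorm[OF f]
      by (intro mult_mono) (auto simp: qform_nonneg)
    finally show "(cmod (pairing (\<lambda>x. f x - lincomb k (approx k f n) x) (approx k g n)))\<^sup>2 \<le>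
        (sqnorm k f - gain k f (approx k f n)) * (2 + 2 * sqnorm k g)" .
  next
    show "(\<lambda>n. (sqnorm k f - gain k f (approx k f n)) * (2 + 2 * sqnorm k g)) \<longlonglongrightarrow> 0"
      by (rule tendsto_mult_left_zero[OF gain_approx_tendsto[OF f]])
  qed
  from tendsto_diff[OF kernel_ip_tendsto[OF f g] this] show ?thesis
    by simp
qed

lemma kernel_ip_sym:
  assumes f: "f \<in> kernel_funs k" and g: "g \<in> kernel_funs k"
  shows "kernel_ip k g f = cnj (kernel_ip k f g)"
proof (rule LIMSEQ_unique[OF kernel_ip_tendsto_approx[OF g f]])
  have "(\<lambda>n. cnj (pairing (lincomb k (approx k f n)) (approx k g n))) \<longlonglongrightarrow> cnj (kernel_ip k f g)"
    by (rule tendsto_cnj[OF kernel_ip_tendsto_approx[OF f g]])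
  then show "(\<lambda>n. pairing (lincomb k (approx k g n)) (approx k f n)) \<longlonglongrightarrow> cnj (kernel_ip k f g)"
    by (subst pairing_swap)
qed

lemma kernel_ip_self:
  assumes f: "f \<in> kernel_funs k"
  shows "kernel_ip k f f = of_real (sqnorm k f)"
proof -
  have q: "(\<lambda>n. complex_of_real (qform k (approx k f n))) \<longlonglongrightarrow> kernel_ip k f f"
    using kernel_ip_tendsto_approx[OF f f] by (simp add: pairing_self)
  have im: "Im (kernel_ip k f f) = 0"
    using tendsto_Im[OF q] by (simp add: LIMSEQ_const_iff)
  have "(\<lambda>n. 2 * Re (pairing f (approx k f n)) - qform k (approx k f n))
      \<longlonglongrightarrow> 2 * Re (kernel_ip k f f) - Re (kernel_ip k f f)"
    using tendsto_Re[OF q] by (intro tendsto_intros kernel_ip_tendsto f) simp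
  moreover have "(\<lambda>n. gain k f (approx k f n)) \<longlonglongrightarrow> sqnorm k f"
    using tendsto_diff[OF tendsto_const[of "sqnorm k f"] gain_approx_tendsto[OF f]] by simp
  ultimately have "Re (kernel_ip k f f) = sqnorm k f"
    unfolding gain_def using LIMSEQ_unique by fastforce
  then show ?thesis
    using im by (simp add: complex_eq_iff)
qed

lemma kernel_ip_lincomb:
  assumes f: "f \<in> kernel_funs k"
  shows "kernel_ip k f (lincomb k cs) = pairing f cs"
proof (rule kernel_ip_eqI[OF f lincomb_kernel_funs])
  let ?g = "lincomb k cs"
  let ?d = "\<lambda>n. sqnorm k ?g - gain k ?g (approx k ?g n)"
  have "(\<lambda>n. pairing f (cs @ scale (-1) (approx k ?g n))) \<longlonglongrightarrow> 0"
  proof (rule square_tendsto_zeroI)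
    fix n
    have "(cmod (pairing f (cs @ scale (-1) (approx k ?g n))))\<^sup>2 \<le>
        sqnorm k f * qform k (cs @ scale (-1) (approx k ?g n))"
      by (rule pairing_bound[OF f])
    then show "(cmod (pairing f (cs @ scale (-1) (approx k ?g n))))\<^sup>2 \<le> sqnorm k f * ?d n"
      by (simp add: gain_lincomb sqnorm_lincomb)
  next
    show "(\<lambda>n. sqnorm k f * ?d n) \<longlonglongrightarrow> 0"
      by (rule tendsto_mult_right_zero[OF gain_approx_tendsto[OF lincomb_kernel_funs]])
  qed
  from tendsto_diff[OF tendsto_const[of "pairing f cs"] this]
  show "(\<lambda>n. pairing f (approx k ?g n)) \<longlonglongrightarrow> pairing f cs"
    by simp
qed

text \<open>A Cauchy sequence converges pointwise, and each single \<open>gain\<close> is continuous for pointwise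
  convergence, so its supremum is lower semicontinuous.\<close>

lemma sqnorm_complete:
  fixes s :: "nat \<Rightarrow> 'a \<Rightarrow> complex"
  assumes s: "\<And>n. s n \<in> kernel_funs k"
    and cauchy: "\<And>e. 0 < e \<Longrightarrow> \<exists>M. \<forall>m\<ge>M. \<forall>n\<ge>M. sqnorm k (\<lambda>x. s m x - s n x) < e"
  shows "\<exists>f \<in> kernel_funs k. (\<lambda>n. sqnorm k (\<lambda>x. s n x - f x)) \<longlonglongrightarrow> 0"
proof -
  have "Cauchy (\<lambda>n. s n x)" for x
  proof (rule metric_CauchyI)
    fix e :: real
    assume "0 < e"
    define c where "c = Re (k x x) + 1"
    have "0 \<le> Re (k x x)"
      using diag_nonneg[of x] by (simp add: less_eq_complex_def)
    then have c: "0 < c"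
      by (simp add: c_def)
    then obtain M where M: "\<forall>m\<ge>M. \<forall>n\<ge>M. sqnorm k (\<lambda>x. s m x - s n x) < e\<^sup>2 / c"
      using cauchy[of "e\<^sup>2 / c"] \<open>0 < e\<close> by auto
    show "\<exists>M. \<forall>m\<ge>M. \<forall>n\<ge>M. dist (s m x) (s n x) < e"
    proof (intro exI[of _ M] allI impI)
      fix m n
      assume mn: "M \<le> m" "M \<le> n"
      let ?S = "sqnorm k (\<lambda>x. s m x - s n x)"
      have "(cmod (s m x - s n x))\<^sup>2 \<le> ?S * Re (k x x)"
        using eval_bound[OF kernel_funs_diff[OF s[of m] s[of n]], of x] by simp
      also have "\<dots> \<le> ?S * c"
        using sqnorm_nonneg[OF kernel_funs_diff[OF s s]] by (intro mult_left_mono) (simp_all add: c_def)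
      also have "\<dots> < e\<^sup>2"
        using M mn c by (simp add: field_simps)
      finally show "dist (s m x) (s n x) < e"
        using \<open>0 < e\<close> by (simp add: dist_norm power2_less_imp_less)
    qed
  qed
  then have "\<forall>x. \<exists>l. (\<lambda>n. s n x) \<longlonglongrightarrow> l"
    by (simp add: Cauchy_convergent_iff convergent_def)
  then obtain f where f: "\<And>x. (\<lambda>n. s n x) \<longlonglongrightarrow> f x"
    by metis
  have close: "(\<lambda>x. s m x - f x) \<in> kernel_funs k \<and> sqnorm k (\<lambda>x. s m x - f x) \<le> e"
    if M: "\<forall>m\<ge>M. \<forall>n\<ge>M. sqnorm k (\<lambda>x. s m x - s n x) < e" and m: "M \<le> m" for m M e
  proof -
    have "gain k (\<lambda>x. s m x - f x) cs \<le> e" for cs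
    proof (rule LIMSEQ_le_const2)
      show "(\<lambda>n. gain k (\<lambda>x. s m x - s n x) cs) \<longlonglongrightarrow> gain k (\<lambda>x. s m x - f x) cs"
        unfolding gain_def by (intro tendsto_intros tendsto_pairing f)
      have "gain k (\<lambda>x. s m x - s n x) cs \<le> e" if "M \<le> n" for n
        using gain_le_sqnorm[OF kernel_funs_diff[OF s[of m] s[of n]], of cs] M m that
        by (meson less_imp_le order_trans)
      then show "\<exists>N. \<forall>n\<ge>N. gain k (\<lambda>x. s m x - s n x) cs \<le> e"
        by blast
    qed
    then show ?thesis
      using sqnorm_leI by blast
  qed
  obtain M where "\<forall>m\<ge>M. \<forall>n\<ge>M. sqnorm k (\<lambda>x. s m x - s n x) < 1"
    using cauchy[of 1] by auto
  then have "(\<lambda>x. s M x - f x) \<in> kernel_funs k"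
    using close by blast
  then have mem: "f \<in> kernel_funs k"
    using kernel_funs_diff[OF s[of M]] by fastforce
  have "(\<lambda>n. sqnorm k (\<lambda>x. s n x - f x)) \<longlonglongrightarrow> 0"
  proof (rule LIMSEQ_I)
    fix e :: real
    assume "0 < e"
    then obtain M where "\<forall>m\<ge>M. \<forall>n\<ge>M. sqnorm k (\<lambda>x. s m x - s n x) < e / 2"
      using cauchy[of "e / 2"] by auto
    then have "norm (sqnorm k (\<lambda>x. s n x - f x) - 0) < e" if "M \<le> n" for n
      using close[OF _ that] sqnorm_nonneg \<open>0 < e\<close> by fastforce
    then show "\<exists>M. \<forall>n\<ge>M. norm (sqnorm k (\<lambda>x. s n x - f x) - 0) < e"
      by blast
  qed
  with mem show ?thesis
    by blast
qed

theorem moore_aronszajn: "\<exists>H. hilbert_fun_space H \<and> reproducing_kernel H k"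
proof -
  define H where "H = \<lparr>funs = kernel_funs k, inner_prod = kernel_ip k\<rparr>"
  have H: "funs H = kernel_funs k" "inner_prod H = kernel_ip k"
    by (simp_all add: H_def)
  have norm: "fnorm H f = sqrt (sqnorm k f)" if "f \<in> kernel_funs k" for f
    using that by (simp add: fnorm_def H kernel_ip_self)
  have add: "kernel_ip k (\<lambda>x. f x + g x) h = kernel_ip k f h + kernel_ip k g h"
    if "f \<in> kernel_funs k" "g \<in> kernel_funs k" "h \<in> kernel_funs k" for f g h
    using that tendsto_add[OF kernel_ip_tendsto kernel_ip_tendsto, of f h g h]
    by (intro kernel_ip_eqI kernel_funs_add) auto
  have scale: "kernel_ip k (\<lambda>x. c * f x) g = c * kernel_ip k f g"
    if "f \<in> kernel_funs k" "g \<in> kernel_funs k" for c f g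
    using that tendsto_mult[OF tendsto_const kernel_ip_tendsto, of f g c]
    by (intro kernel_ip_eqI kernel_funs_scale) auto
  have nonneg: "0 \<le> kernel_ip k f f" if "f \<in> kernel_funs k" for f
    using sqnorm_nonneg[OF that] by (simp add: kernel_ip_self[OF that] less_eq_complex_def)
  have definite: "f = (\<lambda>x. 0)" if f: "f \<in> kernel_funs k" and "kernel_ip k f f = 0" for f
  proof
    fix x
    have "sqnorm k f = 0"
      using kernel_ip_self[OF f] that(2) by simp
    then show "f x = 0"
      using eval_bound[OF f, of x] by simp
  qed
  have complete: "\<exists>f\<in>kernel_funs k. (\<lambda>n. fnorm H (\<lambda>x. s n x - f x)) \<longlonglongrightarrow> 0"
    if s: "\<forall>n. s n \<in> kernel_funs k"
      and cauchy: "\<forall>e>0. \<exists>M. \<forall>m\<ge>M. \<forall>n\<ge>M. fnorm H (\<lambda>x. s m x - s n x) < e" for s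
  proof -
    have "\<exists>f \<in> kernel_funs k. (\<lambda>n. sqnorm k (\<lambda>x. s n x - f x)) \<longlonglongrightarrow> 0"
    proof (rule sqnorm_complete)
      fix e :: real
      assume "0 < e"
      then obtain M where "\<forall>m\<ge>M. \<forall>n\<ge>M. fnorm H (\<lambda>x. s m x - s n x) < sqrt e"
        using cauchy by (meson real_sqrt_gt_zero)
      then show "\<exists>M. \<forall>m\<ge>M. \<forall>n\<ge>M. sqnorm k (\<lambda>x. s m x - s n x) < e"
        using s by (auto simp: norm kernel_funs_diff)
    qed (use s in blast)
    then obtain f where f: "f \<in> kernel_funs k" "(\<lambda>n. sqnorm k (\<lambda>x. s n x - f x)) \<longlonglongrightarrow> 0"
      by blast
    have "(\<lambda>n. fnorm H (\<lambda>x. s n x - f x)) \<longlonglongrightarrow> 0"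
      using tendsto_real_sqrt[OF f(2)] s f(1) by (simp add: norm kernel_funs_diff)
    with f(1) show ?thesis
      by blast
  qed
  have "hilbert_fun_space H"
    unfolding hilbert_fun_space_def H
    by (intro conjI ballI allI impI)
      (simp_all add: kernel_funs_zero kernel_funs_add kernel_funs_scale add scale nonneg definite
        complete kernel_ip_sym[symmetric])
  moreover have "reproducing_kernel H k"
    unfolding reproducing_kernel_def H
    using lincomb_kernel_funs[of "[(1, _)]"] kernel_ip_lincomb[of _ "[(1, _)]"] by simp
  ultimately show ?thesis
    by blast
qed

end

section \<open>Spaces with a reproducing kernel\<close>

locale hilbert_functions =
  fixes H :: "'a fun_space"
  assumes hilbert: "hilbert_fun_space H"
begin

abbreviation ip :: "('a \<Rightarrow> complex) \<Rightarrow> ('a \<Rightarrow> complex) \<Rightarrow> complex" where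
  "ip \<equiv> inner_prod H"

lemmas hilbert_axioms = hilbert[unfolded hilbert_fun_space_def]

lemma zero_mem: "(\<lambda>x. 0) \<in> funs H"
  and add_mem: "f \<in> funs H \<Longrightarrow> g \<in> funs H \<Longrightarrow> (\<lambda>x. f x + g x) \<in> funs H"
  and scale_mem: "f \<in> funs H \<Longrightarrow> (\<lambda>x. c * f x) \<in> funs H"
  using hilbert_axioms by blast+

lemma ip_add: "f \<in> funs H \<Longrightarrow> g \<in> funs H \<Longrightarrow> h \<in> funs H \<Longrightarrow>
    ip (\<lambda>x. f x + g x) h = ip f h + ip g h"
  and ip_scale: "f \<in> funs H \<Longrightarrow> g \<in> funs H \<Longrightarrow> ip (\<lambda>x. c * f x) g = c * ip f g"
  and ip_sym: "f \<in> funs H \<Longrightarrow> g \<in> funs H \<Longrightarrow> ip g f = cnj (ip f g)"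
  using hilbert_axioms by blast+

lemma ip_self_nonneg: "f \<in> funs H \<Longrightarrow> 0 \<le> ip f f"
  and ip_definite: "f \<in> funs H \<Longrightarrow> ip f f = 0 \<Longrightarrow> f = (\<lambda>x. 0)"
  using hilbert_axioms by blast+

lemma complete:
  assumes "\<And>n. s n \<in> funs H"
    and "\<And>e. 0 < e \<Longrightarrow> \<exists>M. \<forall>m\<ge>M. \<forall>n\<ge>M. fnorm H (\<lambda>x. s m x - s n x) < e"
  shows "\<exists>f\<in>funs H. (\<lambda>n. fnorm H (\<lambda>x. s n x - f x)) \<longlonglongrightarrow> 0"
proof -
  have "\<forall>s :: nat \<Rightarrow> 'a \<Rightarrow> complex. (\<forall>n. s n \<in> funs H) \<longrightarrow>
      (\<forall>e > 0. \<exists>M. \<forall>m \<ge> M. \<forall>n \<ge> M. fnorm H (\<lambda>x. s m x - s n x) < e) \<longrightarrow>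
      (\<exists>f \<in> funs H. (\<lambda>n. fnorm H (\<lambda>x. s n x - f x)) \<longlonglongrightarrow> 0)"
    using hilbert_axioms by (elim conjE)
  from this[rule_format, OF assms] show ?thesis .
qed

lemma diff_mem: "f \<in> funs H \<Longrightarrow> g \<in> funs H \<Longrightarrow> (\<lambda>x. f x - g x) \<in> funs H"
  using add_mem[of f "\<lambda>x. (-1) * g x"] scale_mem[of g "-1"] by simp

lemma ip_diff: "f \<in> funs H \<Longrightarrow> g \<in> funs H \<Longrightarrow> h \<in> funs H \<Longrightarrow>
    ip (\<lambda>x. f x - g x) h = ip f h - ip g h"
  using ip_add[of f "\<lambda>x. (-1) * g x" h] scale_mem[of g "-1"] ip_scale[of g h "-1"] by simp

lemma ip_add_right: "f \<in> funs H \<Longrightarrow> g \<in> funs H \<Longrightarrow> h \<in> funs H \<Longrightarrow>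
    ip f (\<lambda>x. g x + h x) = ip f g + ip f h"
  by (simp add: ip_sym[of "\<lambda>x. g x + h x" f] ip_sym[of g f] ip_sym[of h f] ip_add add_mem)

lemma ip_scale_right: "f \<in> funs H \<Longrightarrow> g \<in> funs H \<Longrightarrow> ip f (\<lambda>x. c * g x) = cnj c * ip f g"
  by (simp add: ip_sym[of "\<lambda>x. c * g x" f] ip_sym[of g f] ip_scale scale_mem)

lemma ip_diff_right: "f \<in> funs H \<Longrightarrow> g \<in> funs H \<Longrightarrow> h \<in> funs H \<Longrightarrow>
    ip f (\<lambda>x. g x - h x) = ip f g - ip f h"
  by (simp add: ip_sym[of "\<lambda>x. g x - h x" f] ip_sym[of g f] ip_sym[of h f] ip_diff diff_mem)

lemma ip_zero_right: "f \<in> funs H \<Longrightarrow> ip f (\<lambda>x. 0) = 0"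
  using ip_scale_right[of f "\<lambda>x. 0" 0] zero_mem by simp

lemma fnorm_square: "f \<in> funs H \<Longrightarrow> (fnorm H f)\<^sup>2 = Re (ip f f)"
  using ip_self_nonneg[of f] by (simp add: fnorm_def less_eq_complex_def)

lemma fnorm_nonneg: "f \<in> funs H \<Longrightarrow> 0 \<le> fnorm H f"
  using ip_self_nonneg[of f] by (simp add: fnorm_def less_eq_complex_def)

lemma fnorm_diff_square:
  assumes "f \<in> funs H" "g \<in> funs H"
  shows "(fnorm H (\<lambda>x. f x - g x))\<^sup>2 = (fnorm H f)\<^sup>2 - 2 * Re (ip f g) + (fnorm H g)\<^sup>2"
proof -
  have "ip g f = cnj (ip f g)"
    by (rule ip_sym[OF assms])
  then show ?thesis
    using assms by (simp add: fnorm_square diff_mem ip_diff ip_diff_right)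
qed

end

locale rk_space = hilbert_functions H for H :: "'a fun_space" +
  fixes k :: "'a \<Rightarrow> 'a \<Rightarrow> complex"
  assumes rk: "reproducing_kernel H k"
begin

lemma kernel_mem: "(\<lambda>y. k y x) \<in> funs H"
  and reproduce: "f \<in> funs H \<Longrightarrow> ip f (\<lambda>y. k y x) = f x"
  using rk by (auto simp: reproducing_kernel_def)

lemma lincomb_mem: "lincomb k cs \<in> funs H"
proof (induction cs)
  case (Cons a cs)
  then show ?case
    by (cases a) (simp add: add_mem scale_mem kernel_mem)
qed (simp add: zero_mem)

lemma ip_lincomb: "f \<in> funs H \<Longrightarrow> ip f (lincomb k cs) = pairing f cs"
proof (induction cs)
  case (Cons a cs)
  then show ?case
    by (cases a)
      (simp add: ip_add_right ip_scale_right scale_mem kernel_mem lincomb_mem reproduce)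
qed (simp add: ip_zero_right)

sublocale psd_kernel k
proof
  show "is_kernel k"
    unfolding is_kernel_iff
  proof
    fix cs
    show "0 \<le> pairing (lincomb k cs) cs"
      using ip_self_nonneg[OF lincomb_mem[of cs]] by (simp add: ip_lincomb lincomb_mem)
  qed
qed

lemma fnorm_lincomb: "(fnorm H (lincomb k cs))\<^sup>2 = qform k cs"
  by (simp add: fnorm_square lincomb_mem ip_lincomb qform_def)

lemma gain_eq:
  assumes "f \<in> funs H"
  shows "gain k f cs = (fnorm H f)\<^sup>2 - (fnorm H (\<lambda>x. f x - lincomb k cs x))\<^sup>2"
  using assms by (simp add: fnorm_diff_square lincomb_mem fnorm_lincomb ip_lincomb gain_def)

lemma mem_kernel_funs:
  assumes "f \<in> funs H"
  shows "f \<in> kernel_funs k" "sqnorm k f \<le> (fnorm H f)\<^sup>2"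
proof -
  have "gain k f cs \<le> (fnorm H f)\<^sup>2" for cs
    using gain_eq[OF assms] by simp
  then show "f \<in> kernel_funs k" "sqnorm k f \<le> (fnorm H f)\<^sup>2"
    by (rule sqnorm_leI)+
qed

lemma eval_tendsto:
  assumes "\<And>n. s n \<in> funs H" "f \<in> funs H" "(\<lambda>n. fnorm H (\<lambda>x. s n x - f x)) \<longlonglongrightarrow> 0"
  shows "(\<lambda>n. s n x) \<longlonglongrightarrow> f x"
proof -
  have "(\<lambda>n. s n x - f x) \<longlonglongrightarrow> 0"
  proof (rule square_tendsto_zeroI)
    fix n
    have d: "(\<lambda>x. s n x - f x) \<in> funs H"
      by (rule diff_mem[OF assms(1,2)])
    have "(cmod (s n x - f x))\<^sup>2 \<le> sqnorm k (\<lambda>x. s n x - f x) * Re (k x x)"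
      by (rule eval_bound[OF mem_kernel_funs(1)[OF d]])
    also have "\<dots> \<le> (fnorm H (\<lambda>x. s n x - f x))\<^sup>2 * Re (k x x)"
      using mem_kernel_funs(2)[OF d] diag_nonneg[of x]
      by (intro mult_right_mono) (auto simp: less_eq_complex_def)
    finally show "(cmod (s n x - f x))\<^sup>2 \<le> (fnorm H (\<lambda>x. s n x - f x))\<^sup>2 * Re (k x x)" .
  next
    show "(\<lambda>n. (fnorm H (\<lambda>x. s n x - f x))\<^sup>2 * Re (k x x)) \<longlonglongrightarrow> 0"
      using tendsto_power[OF assms(3), of 2] by (intro tendsto_mult_left_zero) simp
  qed
  then show ?thesis
    by (simp add: LIM_zero_iff)
qed

text \<open>Combinations that nearly attain the supremum of the gain form a Cauchy sequence in \<open>H\<close>,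
  whose limit is \<open>f\<close>.\<close>

lemma kernel_funs_mem:
  assumes f: "f \<in> kernel_funs k"
  shows "f \<in> funs H" "(fnorm H f)\<^sup>2 \<le> sqnorm k f"
proof -
  define u where "u n = lincomb k (approx k f n)" for n
  let ?d = "\<lambda>n. sqnorm k f - gain k f (approx k f n)"
  have u: "u n \<in> funs H" for n
    by (simp add: u_def lincomb_mem)
  have "\<exists>h\<in>funs H. (\<lambda>n. fnorm H (\<lambda>x. u n x - h x)) \<longlonglongrightarrow> 0"
  proof (rule complete[OF u])
    fix e :: real
    assume "0 < e"
    then have "\<forall>\<^sub>F n in sequentially. ?d n < e\<^sup>2 / 4"
      by (intro order_tendstoD[OF gain_approx_tendsto[OF f]]) simp
    then obtain M where M: "\<And>n. M \<le> n \<Longrightarrow> ?d n < e\<^sup>2 / 4"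
      by (auto simp: eventually_sequentially)
    have "fnorm H (\<lambda>x. u m x - u n x) < e" if mn: "M \<le> m" "M \<le> n" for m n
    proof -
      have "(\<lambda>x. u m x - u n x) = lincomb k (approx k f m @ scale (-1) (approx k f n))"
        by (simp add: u_def)
      then have "(fnorm H (\<lambda>x. u m x - u n x))\<^sup>2 =
          qform k (approx k f m @ scale (-1) (approx k f n))"
        by (simp only: fnorm_lincomb)
      also have "\<dots> < e\<^sup>2"
        using qform_diff_bound[OF f, of "approx k f m" "approx k f n"] M[OF mn(1)] M[OF mn(2)]
        unfolding right_diff_distrib by linarith
      finally show ?thesis
        using \<open>0 < e\<close> by (simp add: power2_less_imp_less)
    qed
    then show "\<exists>M. \<forall>m\<ge>M. \<forall>n\<ge>M. fnorm H (\<lambda>x. u m x - u n x) < e"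
      by blast
  qed
  then obtain h where h: "h \<in> funs H" and lim: "(\<lambda>n. fnorm H (\<lambda>x. u n x - h x)) \<longlonglongrightarrow> 0"
    by blast
  have "f x = h x" for x
  proof -
    have "(\<lambda>n. u n x - f x) \<longlonglongrightarrow> 0"
    proof (rule square_tendsto_zeroI)
      fix n
      have "(cmod (f x - u n x))\<^sup>2 \<le> sqnorm k (\<lambda>x. f x - u n x) * Re (k x x)"
        unfolding u_def by (rule eval_bound[OF diff_lincomb(1)[OF f]])
      also have "\<dots> \<le> ?d n * Re (k x x)"
        using diff_lincomb(2)[OF f] diag_nonneg[of x]
        by (intro mult_right_mono) (auto simp: u_def less_eq_complex_def)
      finally show "(cmod (u n x - f x))\<^sup>2 \<le> ?d n * Re (k x x)"
        by (simp add: norm_minus_commute)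
    qed (rule tendsto_mult_left_zero[OF gain_approx_tendsto[OF f]])
    moreover have "(\<lambda>n. u n x - h x) \<longlonglongrightarrow> 0"
      using eval_tendsto[OF u h lim] by (simp add: LIM_zero_iff)
    ultimately have "(\<lambda>n. (u n x - h x) - (u n x - f x)) \<longlonglongrightarrow> 0 - 0"
      by (intro tendsto_diff)
    then show ?thesis
      by (simp add: LIMSEQ_const_iff)
  qed
  then have "f = h"
    by blast
  with h show mem: "f \<in> funs H"
    by simp
  have "(\<lambda>n. (fnorm H f)\<^sup>2 - (fnorm H (\<lambda>x. u n x - f x))\<^sup>2) \<longlonglongrightarrow> (fnorm H f)\<^sup>2 - 0\<^sup>2"
    using lim \<open>f = h\<close> by (intro tendsto_intros) simp
  moreover have "(fnorm H f)\<^sup>2 - (fnorm H (\<lambda>x. u n x - f x))\<^sup>2 \<le> sqnorm k f" for n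
  proof -
    have "(fnorm H (\<lambda>x. u n x - f x))\<^sup>2 = (fnorm H (\<lambda>x. f x - u n x))\<^sup>2"
      using mem u[of n] ip_sym[OF mem u[of n]] by (simp add: fnorm_diff_square)
    then show ?thesis
      using gain_le_sqnorm[OF f, of "approx k f n"] gain_eq[OF mem, of "approx k f n"]
      by (simp add: u_def)
  qed
  ultimately show "(fnorm H f)\<^sup>2 \<le> sqnorm k f"
    using LIMSEQ_le_const2[of _ "(fnorm H f)\<^sup>2 - 0\<^sup>2" "sqnorm k f"] by fastforce
qed

text \<open>Any two spaces with the same kernel agree in functions and norm, since both are given by the
  gain. Only this makes statements about the arbitrarily chosen \<open>rkhs k\<close> meaningful.\<close>

lemma funs_eq: "funs H = kernel_funs k"
  using mem_kernel_funs(1) kernel_funs_mem(1) by blast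

lemma fnorm_eq: "f \<in> funs H \<Longrightarrow> fnorm H f = sqrt (sqnorm k f)"
  using mem_kernel_funs[of f] kernel_funs_mem(2)[of f] fnorm_nonneg[of f]
  by (metis order_antisym real_sqrt_unique)

end

lemma rk_space_rkhs:
  assumes "is_kernel k"
  shows "rk_space (rkhs k) k"
proof -
  interpret psd_kernel k
    by (rule psd_kernel.intro[OF assms])
  have "hilbert_fun_space (rkhs k) \<and> reproducing_kernel (rkhs k) k"
    unfolding rkhs_def by (rule someI_ex[OF moore_aronszajn])
  then show ?thesis
    by unfold_locales auto
qed

section \<open>The kernel of a vanishing subspace\<close>

context rk_space
begin

lemma closed_subspace_hilbert:
  assumes "(\<lambda>x. 0) \<in> V" "V \<subseteq> funs H"
    and "\<And>f g. f \<in> V \<Longrightarrow> g \<in> V \<Longrightarrow> (\<lambda>x. f x + g x) \<in> V"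
    and "\<And>c f. f \<in> V \<Longrightarrow> (\<lambda>x. c * f x) \<in> V"
    and closed: "\<And>s f. (\<And>n :: nat. s n \<in> V) \<Longrightarrow> f \<in> funs H \<Longrightarrow>
      (\<And>x. (\<lambda>n. s n x) \<longlonglongrightarrow> f x) \<Longrightarrow> f \<in> V"
  shows "hilbert_fun_space (H\<lparr>funs := V\<rparr>)"
proof -
  have mem: "f \<in> funs H" if "f \<in> V" for f
    using that assms(2) by blast
  have fnorm: "fnorm (H\<lparr>funs := V\<rparr>) = fnorm H"
    by (simp add: fnorm_def fun_eq_iff)
  have "\<exists>f\<in>V. (\<lambda>n. fnorm H (\<lambda>x. s n x - f x)) \<longlonglongrightarrow> 0"
    if s: "\<forall>n. s n \<in> V"
      and cauchy: "\<forall>e>0. \<exists>M. \<forall>m\<ge>M. \<forall>n\<ge>M. fnorm H (\<lambda>x. s m x - s n x) < e"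
    for s :: "nat \<Rightarrow> 'a \<Rightarrow> complex"
  proof -
    have sH: "s n \<in> funs H" for n
      using s mem by blast
    obtain f where f: "f \<in> funs H" "(\<lambda>n. fnorm H (\<lambda>x. s n x - f x)) \<longlonglongrightarrow> 0"
      using complete[of s, OF sH] cauchy by blast
    have "f \<in> V"
      using closed[of s f] s f(1) eval_tendsto[of s, OF sH f] by blast
    with f(2) show ?thesis
      by blast
  qed
  then show ?thesis
    unfolding hilbert_fun_space_def fnorm
    using assms(1,3,4) mem
    by (intro conjI ballI allI impI)
      (simp_all add: ip_add ip_scale ip_self_nonneg ip_definite ip_sym[symmetric])
qed

lemma vanishing_subspace_hilbert: "hilbert_fun_space (vanishing_subspace H Y)"
  unfolding vanishing_subspace_def
proof (rule closed_subspace_hilbert)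
  fix s :: "nat \<Rightarrow> 'a \<Rightarrow> complex" and f
  assume s: "\<And>n. s n \<in> {f \<in> funs H. \<forall>w\<in>Y. f w = 0}"
    and f: "f \<in> funs H" and lim: "\<And>x. (\<lambda>n. s n x) \<longlonglongrightarrow> f x"
  have "f w = 0" if "w \<in> Y" for w
    using lim[of w] s that by (simp add: LIMSEQ_const_iff)
  with f show "f \<in> {f \<in> funs H. \<forall>w\<in>Y. f w = 0}"
    by blast
qed (auto simp: zero_mem add_mem scale_mem)

text \<open>The functions in \<open>H\<close> that vanish at \<open>w\<close> are those orthogonal to the kernel function at
  \<open>w\<close>, so their kernel is obtained by projecting that function away. If \<open>k w w = 0\<close>, all of
  \<open>H\<close> vanishes at \<open>w\<close>, and division by zero returning zero makes the formula correct.\<close>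

lemma vanishing_point_kernel:
  "reproducing_kernel (vanishing_subspace H {w}) (\<lambda>x y. k x y - k x w * k w y / k w w)"
proof -
  let ?c = "\<lambda>x. k w x / k w w"
  have fun_eq: "(\<lambda>y. k y x - k y w * k w x / k w w) = (\<lambda>y. k y x - ?c x * k y w)" for x
    by (simp add: fun_eq_iff)
  have mem: "(\<lambda>y. k y x - ?c x * k y w) \<in> funs H" for x
    by (intro diff_mem scale_mem kernel_mem)
  have zero: "f w = 0" if f: "f \<in> funs H" and "k w w = 0" for f
    using eval_bound[OF mem_kernel_funs(1)[OF f], of w] that(2) by simp
  have "k w x - k w w * k w x / k w w = 0" for x
    using zero[OF kernel_mem[of x]] by simp
  moreover have "ip f (\<lambda>y. k y x - ?c x * k y w) = f x"
    if f: "f \<in> funs H" and "f w = 0" for f x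
    using ip_diff_right[OF f kernel_mem scale_mem[OF kernel_mem], of x "?c x" w]
      ip_scale_right[OF f kernel_mem, of "?c x" w] that
    by (simp only: reproduce) simp
  ultimately show ?thesis
    unfolding reproducing_kernel_def vanishing_subspace_def
    using mem by (auto simp: fun_eq)
qed

lemma rank_one_kernel: "is_kernel (\<lambda>x y. k x w * k w y / k w w)"
  unfolding is_kernel_iff
proof
  fix cs
  have kw: "k w w = of_real (Re (k w w))"
    using diag_nonneg[of w] by (simp add: complex_eq_iff less_eq_complex_def)
  have "lincomb (\<lambda>x y. k x w * k w y / k w w) cs = (\<lambda>x. (lincomb k cs w / k w w) * k x w)"
    by (induction cs) (auto simp: algebra_simps add_divide_distrib)
  then have "pairing (lincomb (\<lambda>x y. k x w * k w y / k w w) cs) cs =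
      lincomb k cs w * cnj (lincomb k cs w) / k w w"
    by (simp only: pairing_cmult pairing_kernel) simp
  also have "\<dots> = of_real ((cmod (lincomb k cs w))\<^sup>2 / Re (k w w))"
    by (subst kw) (simp only: of_real_divide of_real_power of_real_cmod_square)
  also have "0 \<le> \<dots>"
    using diag_nonneg[of w] by (simp add: less_eq_complex_def)
  finally show "0 \<le> pairing (lincomb (\<lambda>x y. k x w * k w y / k w w) cs) cs" .
qed

end

lemma is_kernel_add:
  assumes "is_kernel k" "is_kernel l"
  shows "is_kernel (\<lambda>x y. k x y + l x y)"
proof -
  have "lincomb (\<lambda>x y. k x y + l x y) cs = (\<lambda>x. lincomb k cs x + lincomb l cs x)" for cs
    by (induction cs) (auto simp: algebra_simps fun_eq_iff)
  then show ?thesis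
    using assms by (simp add: is_kernel_iff)
qed

lemma vanishing_subspace_insert:
  "vanishing_subspace H (insert w Y) = vanishing_subspace (vanishing_subspace H Y) {w}"
proof -
  have "{f \<in> funs H. \<forall>w\<in>insert w Y. f w = 0} = {f \<in> {f \<in> funs H. \<forall>w\<in>Y. f w = 0}. \<forall>w\<in>{w}. f w = 0}"
    by auto
  then show ?thesis
    by (simp only: vanishing_subspace_def) simp
qed

context rk_space
begin

text \<open>Imposing the zeros one point at a time needs no orthogonal projections in general: each point
  subtracts a positive kernel of rank one, and \<open>k - K\<close> is the sum of these.\<close>

lemma ex_vanishing_kernel:
  assumes "finite Y"
  shows "\<exists>K. reproducing_kernel (vanishing_subspace H Y) K \<and> is_kernel (\<lambda>x y. k x y - K x y)"
  using assms
proof (induction Y)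
  case empty
  have "is_kernel (\<lambda>x y :: 'a. 0)"
    by (simp add: is_kernel_def pos_semidef_mat_iff)
  moreover have "vanishing_subspace H {} = H"
    by (simp add: vanishing_subspace_def)
  ultimately show ?case
    using rk by (intro exI[of _ k]) simp
next
  case (insert w Y)
  then obtain K where K: "reproducing_kernel (vanishing_subspace H Y) K"
    "is_kernel (\<lambda>x y. k x y - K x y)"
    by blast
  interpret V: rk_space "vanishing_subspace H Y" K
    by unfold_locales (rule vanishing_subspace_hilbert K(1))+
  have "is_kernel (\<lambda>x y. (k x y - K x y) + K x w * K w y / K w w)"
    by (rule is_kernel_add[OF K(2) V.rank_one_kernel])
  then have "is_kernel (\<lambda>x y. k x y - (K x y - K x w * K w y / K w w))"
    by (simp add: algebra_simps)
  with V.vanishing_point_kernel[of w] show ?case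
    unfolding vanishing_subspace_insert[of H w Y] by blast
qed

lemma reproducing_kernel_unique:
  assumes "reproducing_kernel H K"
  shows "K = k"
proof (intro ext)
  fix x y
  interpret K: rk_space H K
    by unfold_locales (rule assms)
  have "ip (\<lambda>z. k z x) (\<lambda>z. K z y) = k y x"
    by (rule K.reproduce[OF kernel_mem])
  moreover have "ip (\<lambda>z. K z y) (\<lambda>z. k z x) = K x y"
    by (rule reproduce[OF K.kernel_mem])
  ultimately show "K x y = k x y"
    using ip_sym[OF kernel_mem[of x] K.kernel_mem[of y]] hermitian[of x y] by simp
qed

end

lemma vanishing_kernel_properties:
  assumes l: "is_kernel l" and "finite Y"
  shows "rk_space (vanishing_subspace (rkhs l) Y) (vanishing_kernel l Y)"
    and "is_kernel (\<lambda>x y. l x y - vanishing_kernel l Y x y)"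
proof -
  let ?V = "vanishing_subspace (rkhs l) Y"
  interpret rk_space "rkhs l" l
    by (rule rk_space_rkhs[OF l])
  obtain K where K: "reproducing_kernel ?V K" "is_kernel (\<lambda>x y. l x y - K x y)"
    using ex_vanishing_kernel[OF assms(2)] by blast
  interpret V: rk_space ?V K
    by unfold_locales (rule vanishing_subspace_hilbert K(1))+
  have eq: "vanishing_kernel l Y = K"
    unfolding vanishing_kernel_def using K(1) V.reproducing_kernel_unique by (rule the_equality)
  show "rk_space ?V (vanishing_kernel l Y)"
    unfolding eq by (rule V.rk_space_axioms)
  show "is_kernel (\<lambda>x y. l x y - vanishing_kernel l Y x y)"
    unfolding eq by (rule K(2))
qed

lemma vanishing_kernel_zero:
  assumes "is_kernel l" "finite Y" "w \<in> Y"
  shows "vanishing_kernel l Y w x = 0" "vanishing_kernel l Y x w = 0"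
proof -
  interpret V: rk_space "vanishing_subspace (rkhs l) Y" "vanishing_kernel l Y"
    by (rule vanishing_kernel_properties(1)[OF assms(1,2)])
  show zero: "vanishing_kernel l Y w x = 0" for x
    using V.kernel_mem[of x] assms(3) by (auto simp: vanishing_subspace_def)
  show "vanishing_kernel l Y x w = 0"
    using V.hermitian[of x w] zero by simp
qed

text \<open>Multipliers into \<open>rkhs (vanishing_kernel l Y)\<close> refer to an independently chosen space, which
  agrees with the subspace of \<open>rkhs l\<close> because the kernel determines functions and norm.\<close>

lemma rkhs_vanishing_kernel:
  assumes l: "is_kernel l" and "finite Y"
  shows "f \<in> funs (rkhs (vanishing_kernel l Y)) \<longleftrightarrow> f \<in> funs (rkhs l) \<and> (\<forall>w\<in>Y. f w = 0)"
    and "f \<in> funs (rkhs (vanishing_kernel l Y)) \<Longrightarrow>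
      fnorm (rkhs (vanishing_kernel l Y)) f = fnorm (rkhs l) f"
proof -
  let ?V = "vanishing_subspace (rkhs l) Y"
  interpret V: rk_space ?V "vanishing_kernel l Y"
    by (rule vanishing_kernel_properties(1)[OF assms])
  interpret R: rk_space "rkhs (vanishing_kernel l Y)" "vanishing_kernel l Y"
    by (rule rk_space_rkhs[OF V.kernel])
  have eq: "funs (rkhs (vanishing_kernel l Y)) = funs ?V"
    using R.funs_eq V.funs_eq by simp
  then show "f \<in> funs (rkhs (vanishing_kernel l Y)) \<longleftrightarrow> f \<in> funs (rkhs l) \<and> (\<forall>w\<in>Y. f w = 0)"
    by (simp add: vanishing_subspace_def)
  assume f: "f \<in> funs (rkhs (vanishing_kernel l Y))"
  then have "fnorm (rkhs (vanishing_kernel l Y)) f = fnorm ?V f"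
    using eq R.fnorm_eq V.fnorm_eq by simp
  also have "\<dots> = fnorm (rkhs l) f"
    by (simp add: fnorm_def vanishing_subspace_def)
  finally show "fnorm (rkhs (vanishing_kernel l Y)) f = fnorm (rkhs l) f" .
qed

section \<open>Pick matrices\<close>

lemma sum_blocks:
  fixes f :: "nat \<Rightarrow> complex"
  shows "(\<Sum>r<n * N. f r) = (\<Sum>i<n. \<Sum>p<N. f (i * N + p))"
proof -
  have "(\<Sum>r<n * N. f r) = (\<Sum>i<n. sum f {i * N..<i * N + N})"
    by (rule sum.nat_group[symmetric])
  also have "\<dots> = (\<Sum>i<n. \<Sum>p<N. f (i * N + p))"
  proof (rule sum.cong[OF refl])
    fix i
    show "sum f {i * N..<i * N + N} = (\<Sum>p<N. f (i * N + p))"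
      using sum.atLeastLessThan_shift_bounds[of f 0 "i * N" N]
      by (simp add: atLeast0LessThan add.commute)
  qed
  finally show ?thesis .
qed

lemma pos_semidef_block_iff:
  "pos_semidef (block_mat n N B) \<longleftrightarrow>
     (\<forall>v :: nat \<Rightarrow> nat \<Rightarrow> complex.
       0 \<le> (\<Sum>i<n. \<Sum>p<N. \<Sum>j<n. \<Sum>s<N. B i j $$ (p, s) * v j s * cnj (v i p)))"
  (is "_ \<longleftrightarrow> (\<forall>v. 0 \<le> ?Q v)")
proof -
  have form: "(\<Sum>r<n * N. \<Sum>t<n * N. B (r div N) (t div N) $$ (r mod N, t mod N) * u t * cnj (u r)) =
      ?Q (\<lambda>i p. u (i * N + p))" for u :: "nat \<Rightarrow> complex"
    unfolding sum_blocks by (intro sum.cong refl) simp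
  have "pos_semidef (block_mat n N B) \<longleftrightarrow>
      (\<forall>u :: nat \<Rightarrow> complex. 0 \<le> ?Q (\<lambda>i p. u (i * N + p)))"
    unfolding block_mat_def pos_semidef_mat_iff by (simp only: prod.case form)
  also have "\<dots> \<longleftrightarrow> (\<forall>v. 0 \<le> ?Q v)"
  proof
    assume u: "\<forall>u :: nat \<Rightarrow> complex. 0 \<le> ?Q (\<lambda>i p. u (i * N + p))"
    show "\<forall>v. 0 \<le> ?Q v"
    proof
      fix v :: "nat \<Rightarrow> nat \<Rightarrow> complex"
      have "0 \<le> ?Q (\<lambda>i p. v ((i * N + p) div N) ((i * N + p) mod N))"
        using u by (rule allE[of _ "\<lambda>r. v (r div N) (r mod N)"])
      also have "\<dots> = ?Q v"
        by (intro sum.cong refl) simp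
      finally show "0 \<le> ?Q v" .
    qed
  qed simp
  finally show ?thesis .
qed

lemma mat_adjoint_index:
  "i < dim_col A \<Longrightarrow> j < dim_row A \<Longrightarrow> mat_adjoint A $$ (i, j) = conjugate (A $$ (j, i))"
  by (simp add: mat_adjoint_def mat_of_rows_def)

lemma mult_adjoint_index:
  assumes "A \<in> carrier_mat N N" "B \<in> carrier_mat N N" "p < N" "s < N"
  shows "(A * mat_adjoint B) $$ (p, s) = (\<Sum>t<N. A $$ (p, t) * cnj (B $$ (s, t)))"
proof -
  have "dim_row (mat_adjoint B) = N" "dim_col (mat_adjoint B) = N"
    using assms(2) by (auto simp: mat_adjoint_def)
  then show ?thesis
    using assms
    by (auto simp: scalar_prod_def atLeast0LessThan mat_adjoint_index intro!: sum.cong)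
qed

text \<open>Entry \<open>(p, s)\<close> of the \<open>(i, j)\<close> block of a Pick matrix, for points \<open>z\<close> and matrices \<open>W\<close>.\<close>

definition pick_entry ::
  "('a \<Rightarrow> 'a \<Rightarrow> complex) \<Rightarrow> ('a \<Rightarrow> 'a \<Rightarrow> complex) \<Rightarrow> nat \<Rightarrow> (nat \<Rightarrow> 'a) \<Rightarrow> (nat \<Rightarrow> complex mat) \<Rightarrow>
    nat \<Rightarrow> nat \<Rightarrow> nat \<Rightarrow> nat \<Rightarrow> complex" where
  "pick_entry k l N z W i j p s =
     l (z i) (z j) * of_bool (p = s) -
     k (z i) (z j) * (\<Sum>t<N. W i $$ (p, t) * cnj (W j $$ (s, t)))"

definition pick_form ::
  "('a \<Rightarrow> 'a \<Rightarrow> complex) \<Rightarrow> ('a \<Rightarrow> 'a \<Rightarrow> complex) \<Rightarrow> nat \<Rightarrow> nat \<Rightarrow> (nat \<Rightarrow> 'a) \<Rightarrow>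
    (nat \<Rightarrow> complex mat) \<Rightarrow> (nat \<Rightarrow> nat \<Rightarrow> complex) \<Rightarrow> complex" where
  "pick_form k l n N z W v =
     (\<Sum>i<n. \<Sum>p<N. \<Sum>j<n. \<Sum>s<N. pick_entry k l N z W i j p s * v j s * cnj (v i p))"

lemma pick_mat_iff:
  assumes W: "\<forall>i<n. W i \<in> carrier_mat N N"
  shows "pos_semidef (block_mat n N (\<lambda>i j.
      l (z i) (z j) \<cdot>\<^sub>m 1\<^sub>m N - k (z i) (z j) \<cdot>\<^sub>m (W i * mat_adjoint (W j)))) \<longleftrightarrow>
    (\<forall>v. 0 \<le> pick_form k l n N z W v)"
proof -
  have entry: "(l (z i) (z j) \<cdot>\<^sub>m 1\<^sub>m N - k (z i) (z j) \<cdot>\<^sub>m (W i * mat_adjoint (W j))) $$ (p, s) =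
      pick_entry k l N z W i j p s" if "i < n" "j < n" "p < N" "s < N" for i j p s
  proof -
    have c: "W i \<in> carrier_mat N N" "W j \<in> carrier_mat N N"
      using W that by auto
    then have "dim_row (mat_adjoint (W j)) = N" "dim_col (mat_adjoint (W j)) = N"
      by (auto simp: mat_adjoint_def)
    then show ?thesis
      using c that mult_adjoint_index[OF c that(3,4)] by (simp add: pick_entry_def)
  qed
  show ?thesis
    unfolding pos_semidef_block_iff pick_form_def
    by (intro iff_allI arg_cong[where f = "\<lambda>x. 0 \<le> x"] sum.cong refl) (simp add: entry)
qed

lemma complete_Pick_pairD:
  assumes "complete_Pick_pair k l" "n \<ge> 1" "N \<ge> 1" "\<forall>i<n. W i \<in> carrier_mat N N"
    and "\<And>v. 0 \<le> pick_form k l n N z W v"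
  obtains \<Phi> where "\<Phi> \<in> Mult k l N" "mult_norm k l N \<Phi> \<le> 1" "\<And>i. i < n \<Longrightarrow> \<Phi> (z i) = W i"
proof -
  have "pos_semidef (block_mat n N (\<lambda>i j.
      l (z i) (z j) \<cdot>\<^sub>m 1\<^sub>m N - k (z i) (z j) \<cdot>\<^sub>m (W i * mat_adjoint (W j))))"
    using assms(4,5) by (simp add: pick_mat_iff)
  then have "\<exists>\<Phi>\<in>Mult k l N. mult_norm k l N \<Phi> \<le> 1 \<and> (\<forall>i<n. \<Phi> (z i) = W i)"
    using assms(1-4) unfolding complete_Pick_pair_def by blast
  then show ?thesis
    using that by blast
qed

lemma kernel_sum_nonneg:
  fixes n :: nat
  assumes "is_kernel K"
  shows "0 \<le> (\<Sum>i<n. \<Sum>j<n. K (z i) (z j) * v j * cnj (v i))"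
  using assms unfolding is_kernel_def pos_semidef_mat_iff by simp

lemma diagonal_block_nonneg:
  fixes n N :: nat
  assumes K: "is_kernel K"
  shows "0 \<le> (\<Sum>i<n. \<Sum>p<N. \<Sum>j<n. \<Sum>s<N.
    K (z i) (z j) * of_bool (p = s \<and> P p) * v j s * cnj (v i p))"
proof -
  have "(\<Sum>i<n. \<Sum>p<N. \<Sum>j<n. \<Sum>s<N. K (z i) (z j) * of_bool (p = s \<and> P p) * v j s * cnj (v i p))
      = (\<Sum>i<n. \<Sum>p<N. \<Sum>j<n. if P p then K (z i) (z j) * v j p * cnj (v i p) else 0)"
  proof (intro sum.cong refl)
    fix i p j
    assume "p \<in> {..<N}"
    have "(\<Sum>s<N. K (z i) (z j) * of_bool (p = s \<and> P p) * v j s * cnj (v i p)) =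
        (\<Sum>s<N. if p = s then (if P p then K (z i) (z j) * v j p * cnj (v i p) else 0) else 0)"
      by (intro sum.cong refl) auto
    also have "\<dots> = (if P p then K (z i) (z j) * v j p * cnj (v i p) else 0)"
      using \<open>p \<in> {..<N}\<close> by (subst sum.delta') simp_all
    finally show "(\<Sum>s<N. K (z i) (z j) * of_bool (p = s \<and> P p) * v j s * cnj (v i p)) =
        (if P p then K (z i) (z j) * v j p * cnj (v i p) else 0)" .
  qed
  also have "\<dots> = (\<Sum>p<N. \<Sum>i<n. \<Sum>j<n. if P p then K (z i) (z j) * v j p * cnj (v i p) else 0)"
    by (rule sum.swap)
  also have "0 \<le> \<dots>"
  proof (rule sum_nonneg)
    fix p
    show "0 \<le> (\<Sum>i<n. \<Sum>j<n. if P p then K (z i) (z j) * v j p * cnj (v i p) else 0)"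
      using kernel_sum_nonneg[OF K, of z "\<lambda>i. v i p" n] by (cases "P p") simp_all
  qed
  finally show ?thesis .
qed

section \<open>Passing to the vanishing kernel\<close>

text \<open>Prescribing the value zero on \<open>Y\<close> as well turns a Pick problem for \<open>vanishing_kernel l Y\<close>
  into one for \<open>l\<close>. The enlarged Pick matrix is the sum of the given one, padded with zeros, and
  of copies of the positive kernel \<open>l - vanishing_kernel l Y\<close>.\<close>

lemma extended_pick_form_nonneg:
  fixes z :: "nat \<Rightarrow> 'a"
  assumes l: "is_kernel l" and Y: "finite Y"
    and zY: "\<And>i. n \<le> i \<Longrightarrow> i < m \<Longrightarrow> z i \<in> Y"
    and W0: "\<And>i. n \<le> i \<Longrightarrow> i < m \<Longrightarrow> W i = 0\<^sub>m N N"
    and "n \<le> m"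
    and psd: "\<And>v. 0 \<le> pick_form k (vanishing_kernel l Y) n N z W v"
  shows "0 \<le> pick_form k l m N z W v"
proof -
  let ?L = "vanishing_kernel l Y"
  have zero: "pick_entry k ?L N z W i j p s = 0"
    if "i < m" "j < m" "p < N" "s < N" "\<not> (i < n \<and> j < n)" for i j p s
    using that zY[of i] zY[of j] W0[of i] W0[of j] vanishing_kernel_zero[OF l Y]
    by (cases "i < n") (simp_all add: pick_entry_def)
  have "pick_form k ?L m N z W v =
      (\<Sum>i<n. \<Sum>p<N. \<Sum>j<m. \<Sum>s<N. pick_entry k ?L N z W i j p s * v j s * cnj (v i p))"
    unfolding pick_form_def using \<open>n \<le> m\<close> zero
    by (intro sum.mono_neutral_right) (auto intro!: sum.neutral)
  also have "\<dots> = pick_form k ?L n N z W v"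
    unfolding pick_form_def using \<open>n \<le> m\<close> zero
    by (intro sum.cong refl sum.mono_neutral_right) (auto intro!: sum.neutral)
  finally have pad: "pick_form k ?L m N z W v = pick_form k ?L n N z W v" .
  have "pick_form k l m N z W v =
      pick_form k ?L m N z W v + (\<Sum>i<m. \<Sum>p<N. \<Sum>j<m. \<Sum>s<N.
        (l (z i) (z j) - ?L (z i) (z j)) * of_bool (p = s \<and> True) * v j s * cnj (v i p))"
    unfolding pick_form_def pick_entry_def sum.distrib[symmetric]
    by (intro sum.cong refl) (simp add: algebra_simps)
  moreover have "0 \<le> (\<Sum>i<m. \<Sum>p<N. \<Sum>j<m. \<Sum>s<N.
      (l (z i) (z j) - ?L (z i) (z j)) * of_bool (p = s \<and> True) * v j s * cnj (v i p))"
    by (rule diagonal_block_nonneg[OF vanishing_kernel_properties(2)[OF l Y]])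
  ultimately show ?thesis
    using psd[of v] by (simp add: pad)
qed

lemma Mult_vanishing_kernel:
  assumes l: "is_kernel l" and Y: "finite Y"
    and \<Phi>: "\<Phi> \<in> Mult k l N" "mult_norm k l N \<Phi> \<le> 1"
    and zero: "\<And>y. y \<in> Y \<Longrightarrow> \<Phi> y = 0\<^sub>m N N"
  shows "\<Phi> \<in> Mult k (vanishing_kernel l Y) N" "mult_norm k (vanishing_kernel l Y) N \<Phi> \<le> 1"
proof -
  let ?L = "vanishing_kernel l Y"
  have carrier: "\<Phi> x \<in> carrier_mat N N" for x
    using \<Phi>(1) by (simp add: Mult_def)
  have comp: "(\<lambda>x. (\<Phi> x *\<^sub>v F x) $ i) \<in> funs (rkhs ?L)"
    if F: "F \<in> tensor_funs (rkhs k) N" and i: "i < N" for F i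
  proof -
    have "(\<lambda>x. (\<Phi> x *\<^sub>v F x) $ i) \<in> funs (rkhs l)"
      using \<Phi>(1) F i by (simp add: Mult_def tensor_funs_def)
    moreover have "(\<Phi> y *\<^sub>v F y) $ i = 0" if "y \<in> Y" for y
    proof -
      have "F y \<in> carrier_vec N"
        using F by (simp add: tensor_funs_def)
      then show ?thesis
        using zero[OF that] i by (simp add: scalar_prod_def)
    qed
    ultimately show ?thesis
      using rkhs_vanishing_kernel(1)[OF l Y] by simp
  qed
  have norm: "tensor_norm (rkhs ?L) N (\<lambda>x. \<Phi> x *\<^sub>v F x) = tensor_norm (rkhs l) N (\<lambda>x. \<Phi> x *\<^sub>v F x)"
    if "F \<in> tensor_funs (rkhs k) N" for F
    using rkhs_vanishing_kernel(2)[OF l Y comp[OF that]] by (simp add: tensor_norm_def)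
  have "(\<lambda>x. \<Phi> x *\<^sub>v F x) \<in> tensor_funs (rkhs ?L) N" if "F \<in> tensor_funs (rkhs k) N" for F
    unfolding tensor_funs_def using carrier comp[OF that] that
    by (auto simp: tensor_funs_def intro!: mult_mat_vec_carrier)
  then show "\<Phi> \<in> Mult k ?L N"
    using carrier by (simp add: Mult_def)
  show "mult_norm k ?L N \<Phi> \<le> 1"
    using \<Phi>(2) norm by (simp add: mult_norm_def)
qed

theorem complete_Pick_pair_vanishing_kernel:
  fixes k l :: "'a \<Rightarrow> 'a \<Rightarrow> complex"
  assumes Pick: "complete_Pick_pair k l" and Y: "finite Y"
  shows "complete_Pick_pair k (vanishing_kernel l Y)"
proof -
  let ?L = "vanishing_kernel l Y"
  have k: "is_kernel k" and l: "is_kernel l"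
    using Pick by (simp_all add: complete_Pick_pair_def)
  interpret V: rk_space "vanishing_subspace (rkhs l) Y" ?L
    by (rule vanishing_kernel_properties(1)[OF l Y])
  have "\<exists>\<Phi>\<in>Mult k ?L N. mult_norm k ?L N \<Phi> \<le> 1 \<and> (\<forall>i<n. \<Phi> (z i) = W i)"
    if n: "n \<ge> 1" and N: "N \<ge> 1" and W: "\<forall>i<n. W i \<in> carrier_mat N N"
      and psd: "pos_semidef (block_mat n N (\<lambda>i j.
        ?L (z i) (z j) \<cdot>\<^sub>m 1\<^sub>m N - k (z i) (z j) \<cdot>\<^sub>m (W i * mat_adjoint (W j))))"
    for n N and z :: "nat \<Rightarrow> 'a" and W
  proof -
    obtain ys where ys: "set ys = Y"
      using finite_list[OF Y] by blast
    define m where "m = n + length ys"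
    define z' where "z' i = (if i < n then z i else ys ! (i - n))" for i
    define W' where "W' i = (if i < n then W i else 0\<^sub>m N N)" for i
    have "pick_form k ?L n N z' W' v = pick_form k ?L n N z W v" for v
      unfolding pick_form_def pick_entry_def z'_def W'_def by (intro sum.cong refl) simp
    then have "0 \<le> pick_form k ?L n N z' W' v" for v
      using psd by (simp add: pick_mat_iff[OF W])
    then have "0 \<le> pick_form k l m N z' W' v" for v
    proof (rule extended_pick_form_nonneg[OF l Y, rotated -1])
      show "z' i \<in> Y" if "n \<le> i" "i < m" for i
      proof -
        have "i - n < length ys"
          using that by (simp add: m_def)
        then show ?thesis
          using that ys by (auto simp: z'_def)
      qed
    qed (simp_all add: W'_def m_def)
    moreover have "m \<ge> 1" "\<forall>i<m. W' i \<in> carrier_mat N N"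
      using n W by (auto simp: m_def W'_def)
    ultimately obtain \<Phi> where \<Phi>: "\<Phi> \<in> Mult k l N" "mult_norm k l N \<Phi> \<le> 1"
      and val: "\<And>i. i < m \<Longrightarrow> \<Phi> (z' i) = W' i"
      using complete_Pick_pairD[OF Pick _ N, of m W' z'] by blast
    have "\<Phi> y = 0\<^sub>m N N" if "y \<in> Y" for y
    proof -
      obtain i where "i < length ys" "y = ys ! i"
        using \<open>y \<in> Y\<close> ys by (metis in_set_conv_nth)
      then show ?thesis
        using val[of "n + i"] by (simp add: m_def z'_def W'_def)
    qed
    then have "\<Phi> \<in> Mult k ?L N" "mult_norm k ?L N \<Phi> \<le> 1"
      using Mult_vanishing_kernel[OF l Y \<Phi>] by blast+
    moreover have "\<forall>i<n. \<Phi> (z i) = W i"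
    proof (intro allI impI)
      fix i
      assume "i < n"
      then show "\<Phi> (z i) = W i"
        using val[of i] by (simp add: m_def z'_def W'_def)
    qed
    ultimately show ?thesis
      by blast
  qed
  then show ?thesis
    unfolding complete_Pick_pair_def using k V.kernel by blast
qed

section \<open>Contractive multipliers\<close>

lemma (in hilbert_functions) fnorm_scale:
  assumes "f \<in> funs H"
  shows "fnorm H (\<lambda>x. c * f x) = cmod c * fnorm H f"
proof -
  have "ip (\<lambda>x. c * f x) (\<lambda>x. c * f x) = of_real ((cmod c)\<^sup>2) * ip f f"
    using assms by (simp add: ip_scale ip_scale_right scale_mem of_real_cmod_square)
  then show ?thesis
    by (simp only: fnorm_def Re_of_real_mult real_sqrt_mult real_sqrt_abs abs_norm_cancel)
qed

lemma tensor_norm_scale: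
  assumes k: "is_kernel k" and F: "F \<in> tensor_funs (rkhs k) N"
  shows "(\<lambda>x. c \<cdot>\<^sub>v F x) \<in> tensor_funs (rkhs k) N"
    and "tensor_norm (rkhs k) N (\<lambda>x. c \<cdot>\<^sub>v F x) = cmod c * tensor_norm (rkhs k) N F"
proof -
  interpret rk_space "rkhs k" k
    by (rule rk_space_rkhs[OF k])
  have carrier: "F x \<in> carrier_vec N" and mem: "i < N \<Longrightarrow> (\<lambda>x. F x $ i) \<in> funs (rkhs k)" for x i
    using F by (auto simp: tensor_funs_def)
  have comp: "(\<lambda>x. (c \<cdot>\<^sub>v F x) $ i) = (\<lambda>x. c * F x $ i)" if "i < N" for i
    using carrier_vecD[OF carrier] that by (simp add: fun_eq_iff)
  show "(\<lambda>x. c \<cdot>\<^sub>v F x) \<in> tensor_funs (rkhs k) N"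
    using carrier comp mem scale_mem by (simp add: tensor_funs_def)
  have "tensor_norm (rkhs k) N (\<lambda>x. c \<cdot>\<^sub>v F x) =
      sqrt (\<Sum>i<N. (cmod c * fnorm (rkhs k) (\<lambda>x. F x $ i))\<^sup>2)"
    unfolding tensor_norm_def
    by (intro arg_cong[where f = sqrt] sum.cong refl) (simp add: comp fnorm_scale mem)
  also have "\<dots> = cmod c * tensor_norm (rkhs k) N F"
    by (simp add: tensor_norm_def power_mult_distrib real_sqrt_mult flip: sum_distrib_left)
  finally show "tensor_norm (rkhs k) N (\<lambda>x. c \<cdot>\<^sub>v F x) = cmod c * tensor_norm (rkhs k) N F" .
qed

lemma mult_norm_contraction:
  assumes k: "is_kernel k" and m: "is_kernel m"
    and \<Phi>: "\<Phi> \<in> Mult k m N" "mult_norm k m N \<Phi> \<le> 1"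
    and F: "F \<in> tensor_funs (rkhs k) N"
  shows "tensor_norm (rkhs m) N (\<lambda>x. \<Phi> x *\<^sub>v F x) \<le> tensor_norm (rkhs k) N F"
proof (rule field_le_epsilon)
  fix e :: real
  assume "0 < e"
  \<comment> \<open>Rescaling by a number above the norm, not the norm itself, includes the case of norm zero.\<close>
  define r where "r = tensor_norm (rkhs k) N F + e"
  have "0 \<le> tensor_norm (rkhs k) N F"
    by (simp add: tensor_norm_def sum_nonneg)
  then have r: "0 < r" "tensor_norm (rkhs k) N F \<le> r"
    using \<open>0 < e\<close> by (simp_all add: r_def)
  let ?c = "complex_of_real (1 / r)"
  let ?G = "\<lambda>x. ?c \<cdot>\<^sub>v F x"
  have \<Phi>F: "(\<lambda>x. \<Phi> x *\<^sub>v F x) \<in> tensor_funs (rkhs m) N"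
    using \<Phi>(1) F by (simp add: Mult_def)
  have carrier: "\<Phi> x \<in> carrier_mat N N" "F x \<in> carrier_vec N" for x
    using \<Phi>(1) F by (auto simp: Mult_def tensor_funs_def)
  have "tensor_norm (rkhs k) N ?G \<le> 1"
    using r tensor_norm_scale(2)[OF k F, of ?c] by (simp add: norm_divide)
  then have "ennreal (tensor_norm (rkhs m) N (\<lambda>x. \<Phi> x *\<^sub>v ?G x)) \<le> mult_norm k m N \<Phi>"
    unfolding mult_norm_def using tensor_norm_scale(1)[OF k F, of ?c]
    by (intro SUP_upper) simp
  also have "\<dots> \<le> 1"
    by (rule \<Phi>(2))
  finally have "tensor_norm (rkhs m) N (\<lambda>x. \<Phi> x *\<^sub>v ?G x) \<le> 1"
    by simp
  moreover have "(\<lambda>x. \<Phi> x *\<^sub>v ?G x) = (\<lambda>x. ?c \<cdot>\<^sub>v (\<Phi> x *\<^sub>v F x))"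
    using mult_mat_vec[OF carrier] by (simp add: fun_eq_iff)
  ultimately have "tensor_norm (rkhs m) N (\<lambda>x. \<Phi> x *\<^sub>v F x) / r \<le> 1"
    using tensor_norm_scale(2)[OF m \<Phi>F, of ?c] r by (simp add: norm_divide)
  then show "tensor_norm (rkhs m) N (\<lambda>x. \<Phi> x *\<^sub>v F x) \<le> tensor_norm (rkhs k) N F + e"
    using r(1) by (simp add: r_def)
qed

text \<open>The adjoint of multiplication by \<open>\<phi>\<close> sends \<open>lincomb m cs\<close> to \<open>lincomb k (twist \<phi> cs)\<close>.\<close>

definition twist :: "('a \<Rightarrow> complex) \<Rightarrow> 'a comb \<Rightarrow> 'a comb" where
  "twist \<phi> cs = map (\<lambda>(c, y). (c * cnj (\<phi> y), y)) cs"

lemma pairing_twist: "pairing f (twist \<phi> cs) = pairing (\<lambda>x. \<phi> x * f x) cs"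
  by (induction cs) (auto simp: twist_def)

lemma lincomb_twist: "lincomb (\<lambda>x y. k x y * (\<phi> x * cnj (\<phi> y))) cs = (\<lambda>x. \<phi> x * lincomb k (twist \<phi> cs) x)"
  by (induction cs) (auto simp: twist_def fun_eq_iff algebra_simps)

lemma lincomb_kernel_sum: "lincomb (\<lambda>x y. \<Sum>p\<in>P. k p x y) cs = (\<lambda>x. \<Sum>p\<in>P. lincomb (k p) cs x)"
  by (induction cs) (auto simp: fun_eq_iff sum.distrib sum_distrib_left)

text \<open>Apply the multiplier to the element \<open>F\<close> of \<open>rkhs k\<close> tensor \<open>\<complex>\<^sup>N\<close> that the adjoint
  assigns to \<open>lincomb m cs\<close> in the first component. Testing the first component of the image
  against \<open>cs\<close> returns the squared norm \<open>A\<close> of \<open>F\<close>, so contractivity gives \<open>A \<le> qform m cs\<close>,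
  which is positivity at \<open>cs\<close>.\<close>

lemma contractive_row_kernel:
  fixes k m :: "'a \<Rightarrow> 'a \<Rightarrow> complex"
  assumes k: "is_kernel k" and m: "is_kernel m" and N: "1 \<le> N"
    and \<Phi>: "\<Phi> \<in> Mult k m N" "mult_norm k m N \<Phi> \<le> 1"
  shows "is_kernel (\<lambda>x y. m x y - k x y * (\<Sum>p<N. \<Phi> x $$ (0, p) * cnj (\<Phi> y $$ (0, p))))"
    (is "is_kernel ?D")
  unfolding is_kernel_iff
proof
  fix cs :: "'a comb"
  interpret K: rk_space "rkhs k" k
    by (rule rk_space_rkhs[OF k])
  interpret M: rk_space "rkhs m" m
    by (rule rk_space_rkhs[OF m])
  define ts where "ts p = twist (\<lambda>x. \<Phi> x $$ (0, p)) cs" for p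
  define F where "F x = vec N (\<lambda>p. lincomb k (ts p) x)" for x
  define A where "A = (\<Sum>p<N. qform k (ts p))"
  define f where "f x = (\<Sum>p<N. \<Phi> x $$ (0, p) * lincomb k (ts p) x)" for x
  have F: "F \<in> tensor_funs (rkhs k) N"
    by (auto simp: tensor_funs_def F_def K.lincomb_mem)
  have "tensor_norm (rkhs k) N F = sqrt A"
    unfolding tensor_norm_def A_def
    by (intro arg_cong[where f = sqrt] sum.cong refl) (simp add: F_def K.fnorm_lincomb)
  with mult_norm_contraction[OF k m \<Phi> F]
  have contraction: "tensor_norm (rkhs m) N (\<lambda>x. \<Phi> x *\<^sub>v F x) \<le> sqrt A"
    by simp
  have carrier: "\<Phi> x \<in> carrier_mat N N" for x
    using \<Phi>(1) by (simp add: Mult_def)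
  have row: "(\<lambda>x. (\<Phi> x *\<^sub>v F x) $ 0) = f"
    using N carrier_matD[OF carrier]
    by (auto simp: f_def F_def scalar_prod_def atLeast0LessThan fun_eq_iff intro!: sum.cong)
  have f: "f \<in> funs (rkhs m)"
    using \<Phi>(1) F N by (auto simp: Mult_def tensor_funs_def simp flip: row)
  have "(fnorm (rkhs m) f)\<^sup>2 \<le> (\<Sum>i<N. (fnorm (rkhs m) (\<lambda>x. (\<Phi> x *\<^sub>v F x) $ i))\<^sup>2)"
    using N by (subst row[symmetric], intro member_le_sum) auto
  also have "\<dots> \<le> A"
    using contraction by (simp add: tensor_norm_def)
  finally have "(fnorm (rkhs m) f)\<^sup>2 \<le> A" .
  then have gain: "gain m f cs \<le> A"
    using M.gain_eq[OF f, of cs] zero_le_power2[of "fnorm (rkhs m) (\<lambda>x. f x - lincomb m cs x)"]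
    by linarith
  have pairing: "pairing f cs = of_real A"
  proof -
    have "pairing f cs = (\<Sum>p<N. pairing (\<lambda>x. \<Phi> x $$ (0, p) * lincomb k (ts p) x) cs)"
      unfolding f_def by (rule pairing_sum)
    also have "\<dots> = (\<Sum>p<N. pairing (lincomb k (ts p)) (ts p))"
      by (intro sum.cong refl, subst (2) ts_def) (rule pairing_twist[symmetric])
    also have "\<dots> = of_real A"
      by (simp add: A_def K.pairing_self)
    finally show ?thesis .
  qed
  have "lincomb (\<lambda>x y. k x y * (\<Sum>p<N. \<Phi> x $$ (0, p) * cnj (\<Phi> y $$ (0, p)))) cs = f"
    unfolding sum_distrib_left lincomb_kernel_sum f_def ts_def
    by (subst lincomb_twist) simp
  then have "pairing (lincomb ?D cs) cs = of_real (qform m cs - A)"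
    by (simp add: lincomb_kernel_diff M.pairing_self pairing)
  moreover have "A \<le> qform m cs"
    using gain by (simp add: gain_def pairing)
  ultimately show "0 \<le> pairing (lincomb ?D cs) cs"
    by (simp add: less_eq_complex_def)
qed

section \<open>Factorization on finite sets\<close>

text \<open>If \<open>m = k g\<close> on \<open>F\<close> with \<open>g x y\<close> the inner product of vectors \<open>w x\<close> and \<open>w y\<close>, then the Pick
  matrix of the data whose first row is \<open>w\<close> and whose other rows vanish is positive: the first
  diagonal block cancels, and the others are copies of \<open>m\<close>. Hence the rows \<open>w\<close> extend to all of
  the underlying set, leaving a positive defect.\<close>

lemma extend_factorization:
  fixes k m :: "'a \<Rightarrow> 'a \<Rightarrow> complex"
  assumes Pick: "complete_Pick_pair k m" and F: "finite F" "F \<noteq> {}" and N: "1 \<le> N"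
    and w: "\<And>x y. x \<in> F \<Longrightarrow> y \<in> F \<Longrightarrow> m x y = k x y * (\<Sum>p<N. w x p * cnj (w y p))"
  obtains \<phi> :: "'a \<Rightarrow> nat \<Rightarrow> complex"
  where "is_kernel (\<lambda>x y. m x y - k x y * (\<Sum>p<N. \<phi> x p * cnj (\<phi> y p)))"
    and "\<And>x p. x \<in> F \<Longrightarrow> p < N \<Longrightarrow> \<phi> x p = w x p"
proof -
  have k: "is_kernel k" and m: "is_kernel m"
    using Pick by (simp_all add: complete_Pick_pair_def)
  obtain zs where zs: "set zs = F"
    using finite_list[OF F(1)] by blast
  define n where "n = length zs"
  define z where "z i = zs ! i" for i
  define W where "W i = mat N N (\<lambda>(r, p). if r = 0 then w (z i) p else 0)" for i
  have zF: "z i \<in> F" if "i < n" for i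
    using that zs by (auto simp: z_def n_def)
  have "n \<ge> 1"
    using F(2) zs by (cases zs) (auto simp: n_def)
  have "0 \<le> pick_form k m n N z W v" for v
  proof -
    have entry: "pick_entry k m N z W i j p s = m (z i) (z j) * of_bool (p = s \<and> p \<noteq> 0)"
      if "i < n" "j < n" "p < N" "s < N" for i j p s
      using that w[OF zF[OF that(1)] zF[OF that(2)]] by (simp add: pick_entry_def W_def)
    have "pick_form k m n N z W v = (\<Sum>i<n. \<Sum>p<N. \<Sum>j<n. \<Sum>s<N.
        m (z i) (z j) * of_bool (p = s \<and> p \<noteq> 0) * v j s * cnj (v i p))"
      unfolding pick_form_def by (intro sum.cong refl) (simp add: entry)
    then show ?thesis
      using diagonal_block_nonneg[OF m] by simp
  qed
  then obtain \<Phi> where \<Phi>: "\<Phi> \<in> Mult k m N" "mult_norm k m N \<Phi> \<le> 1"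
    and val: "\<And>i. i < n \<Longrightarrow> \<Phi> (z i) = W i"
    using complete_Pick_pairD[OF Pick \<open>n \<ge> 1\<close> N, of W z] by (auto simp: W_def)
  show ?thesis
  proof (rule that)
    show "is_kernel (\<lambda>x y. m x y - k x y * (\<Sum>p<N. \<Phi> x $$ (0, p) * cnj (\<Phi> y $$ (0, p))))"
      by (rule contractive_row_kernel[OF k m N \<Phi>])
    fix x p
    assume "x \<in> F" "p < N"
    then obtain i where "i < n" "x = z i"
      using zs by (metis in_set_conv_nth n_def z_def)
    then show "\<Phi> x $$ (0, p) = w x p"
      using val[of i] N \<open>p < N\<close> by (simp add: W_def)
  qed
qed

lemma (in psd_kernel) kernel_Cauchy_Schwarz: "(cmod (k x y))\<^sup>2 \<le> Re (k x x) * Re (k y y)"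
  using eval_bound[OF lincomb_kernel_funs[of "[(1, y)]"], of x] sqnorm_lincomb[of "[(1, y)]"]
  by (simp add: qform_point mult.commute)

lemma (in psd_kernel) zero_if_diag_zero:
  assumes "k x x = 0"
  shows "k x y = 0" "k y x = 0"
  using kernel_Cauchy_Schwarz[of x y] kernel_Cauchy_Schwarz[of y x] assms by simp_all

text \<open>The defect \<open>D\<close> of such an extension vanishes on \<open>F\<close>, and by positivity also between \<open>F\<close>
  and any new point \<open>a\<close>. What remains is its value at \<open>(a, a)\<close>, which one additional coordinate
  of the vectors absorbs because \<open>k a a \<noteq> 0\<close>.\<close>

lemma finite_factorization:
  fixes k m :: "'a \<Rightarrow> 'a \<Rightarrow> complex"
  assumes Pick: "complete_Pick_pair k m" and diag: "\<And>x. k x x \<noteq> 0" and F: "finite F"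
  shows "\<exists>N\<ge>1. \<exists>w :: 'a \<Rightarrow> nat \<Rightarrow> complex.
    \<forall>x\<in>F. \<forall>y\<in>F. m x y = k x y * (\<Sum>p<N. w x p * cnj (w y p))"
  using F
proof (induction F)
  case empty
  then show ?case
    by auto
next
  case (insert a F)
  interpret K: psd_kernel k
    using Pick by unfold_locales (simp add: complete_Pick_pair_def)
  have m: "is_kernel m"
    using Pick by (simp add: complete_Pick_pair_def)
  obtain N :: nat and w :: "'a \<Rightarrow> nat \<Rightarrow> complex" where N: "1 \<le> N"
    and w: "\<And>x y. x \<in> F \<Longrightarrow> y \<in> F \<Longrightarrow> m x y = k x y * (\<Sum>p<N. w x p * cnj (w y p))"
    using insert.IH by blast
  define D where "D \<phi> x y = m x y - k x y * (\<Sum>p<N. \<phi> x p * cnj (\<phi> y p))"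
    for \<phi> :: "'a \<Rightarrow> nat \<Rightarrow> complex" and x y
  obtain \<phi> where ker: "is_kernel (D \<phi>)" and zero: "\<And>x. x \<in> F \<Longrightarrow> D \<phi> x x = 0"
  \<comment> \<open>Pick problems have at least one point, so without old points there is nothing to extend.\<close>
  proof (cases "F = {}")
    case True
    have "D (\<lambda>x p. 0) = m"
      by (simp add: D_def fun_eq_iff)
    then show ?thesis
      using that[of "\<lambda>x p. 0"] m True by simp
  next
    case False
    show ?thesis
    proof (rule extend_factorization[OF Pick insert.hyps(1) False N w])
      fix \<phi> :: "'a \<Rightarrow> nat \<Rightarrow> complex"
      assume \<phi>: "is_kernel (\<lambda>x y. m x y - k x y * (\<Sum>p<N. \<phi> x p * cnj (\<phi> y p)))"
        and eq: "\<And>x p. x \<in> F \<Longrightarrow> p < N \<Longrightarrow> \<phi> x p = w x p"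
      have "D \<phi> = (\<lambda>x y. m x y - k x y * (\<Sum>p<N. \<phi> x p * cnj (\<phi> y p)))"
        by (simp add: D_def fun_eq_iff)
      with \<phi> have "is_kernel (D \<phi>)"
        by simp
      moreover have "D \<phi> x x = 0" if "x \<in> F" for x
        using w[OF that that] eq[OF that] by (simp add: D_def)
      ultimately show ?thesis
        by (rule that)
    qed
  qed
  interpret D: psd_kernel "D \<phi>"
    by unfold_locales (rule ker)
  define d where "d = Re (D \<phi> a a) / Re (k a a)"
  have nonneg: "0 \<le> Re (k a a)" "0 \<le> Re (D \<phi> a a)"
    and real: "k a a = of_real (Re (k a a))" "D \<phi> a a = of_real (Re (D \<phi> a a))"
    using K.diag_nonneg[of a] D.diag_nonneg[of a] by (auto simp: less_eq_complex_def complex_eq_iff)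
  have "Re (k a a) \<noteq> 0"
    using diag[of a] real(1) by (metis of_real_0)
  have "0 \<le> d"
    using nonneg by (simp add: d_def)
  have Da: "D \<phi> a a = k a a * of_real d"
  proof -
    have "Re (D \<phi> a a) = Re (k a a) * d"
      using \<open>Re (k a a) \<noteq> 0\<close> by (simp add: d_def)
    then have "D \<phi> a a = of_real (Re (k a a)) * of_real d"
      by (metis real(2) of_real_mult)
    then show ?thesis
      by (simp only: real(1)[symmetric])
  qed
  define w' where "w' x p = (if p < N then \<phi> x p else if x = a then of_real (sqrt d) else 0)" for x p
  have factor: "m x y = k x y * (\<Sum>p<Suc N. w' x p * cnj (w' y p))"
    if "x \<in> insert a F" "y \<in> insert a F" for x y
  proof -
    have "D \<phi> x y = k x y * (w' x N * cnj (w' y N))"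
    proof (cases "x = a \<and> y = a")
      case True
      then show ?thesis
        using Da \<open>0 \<le> d\<close> by (simp add: w'_def flip: of_real_mult)
    next
      case False
      then have "x \<in> F \<or> y \<in> F"
        using that by blast
      then have "D \<phi> x y = 0"
        using zero D.zero_if_diag_zero by blast
      then show ?thesis
        using False by (simp add: w'_def)
    qed
    then have "m x y = k x y * (\<Sum>p<N. \<phi> x p * cnj (\<phi> y p)) + k x y * (w' x N * cnj (w' y N))"
      by (simp add: D_def algebra_simps)
    also have "(\<Sum>p<N. \<phi> x p * cnj (\<phi> y p)) = (\<Sum>p<N. w' x p * cnj (w' y p))"
      by (simp add: w'_def)
    finally show ?thesis
      by (simp add: distrib_left)
  qed
  show ?case
    by (intro exI[of _ "Suc N"] conjI exI[of _ w'] ballI factor) simp_all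
qed

section \<open>Compactness\<close>

lemma is_kernel_gram: "is_kernel (\<lambda>x y. \<Sum>p<N. w x p * cnj (w y p))"
proof -
  have "pairing (lincomb (\<lambda>x y. \<Sum>p<N. w x p * cnj (w y p)) cs) cs =
      of_real (\<Sum>p<N. (cmod (pairing (\<lambda>x. w x p) cs))\<^sup>2)" for cs
  proof -
    have lin: "lincomb (\<lambda>x y. w x p * cnj (w y p)) cs = (\<lambda>x. cnj (pairing (\<lambda>x. w x p) cs) * w x p)" for p
      by (induction cs) (auto simp: fun_eq_iff algebra_simps)
    show ?thesis
      by (simp only: lincomb_kernel_sum lin pairing_sum pairing_cmult of_real_sum of_real_power
          of_real_cmod_square) (simp only: mult.commute)
  qed
  then show ?thesis
    by (simp add: is_kernel_iff less_eq_complex_def sum_nonneg del: of_real_sum)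
qed

lemma compact_complex_box: "compact {c. \<bar>Re c\<bar> \<le> r \<and> \<bar>Im c\<bar> \<le> r}"
proof -
  have "compact ((\<lambda>(a, b). of_real a + \<i> * of_real b) ` ({-r..r} \<times> {-r..r}) :: complex set)"
    by (intro compact_continuous_image compact_Times compact_Icc)
      (auto simp: case_prod_unfold intro!: continuous_intros)
  also have "(\<lambda>(a, b). of_real a + \<i> * of_real b) ` ({-r..r} \<times> {-r..r}) =
      {c. \<bar>Re c\<bar> \<le> r \<and> \<bar>Im c\<bar> \<le> r}"
    by (auto simp: image_iff complex_eq_iff abs_le_iff minus_le_iff Bex_def)
  finally show ?thesis .
qed

lemma compact_function_box:
  fixes R :: "'b \<Rightarrow> real"
  shows "compact {G :: 'b \<Rightarrow> complex. \<forall>u. \<bar>Re (G u)\<bar> \<le> R u \<and> \<bar>Im (G u)\<bar> \<le> R u}"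
proof -
  have "compactin (product_topology (\<lambda>_. euclidean) UNIV)
      (PiE UNIV (\<lambda>u. {c. \<bar>Re c\<bar> \<le> R u \<and> \<bar>Im c\<bar> \<le> R u}))"
    by (simp add: compactin_PiE compact_complex_box)
  then show ?thesis
    by (simp add: euclidean_product_topology PiE_UNIV_domain Pi_def)
qed

lemma closed_kernels: "closed {G :: 'a \<times> 'a \<Rightarrow> complex. is_kernel (\<lambda>x y. G (x, y))}"
proof -
  have eval: "continuous_on UNIV (\<lambda>G :: 'a \<times> 'a \<Rightarrow> complex. G u)" for u
    by (rule continuous_on_product_coordinates)
  have lin: "continuous_on UNIV (\<lambda>G :: 'a \<times> 'a \<Rightarrow> complex. lincomb (\<lambda>x y. G (x, y)) cs x)" for cs x
  proof (induction cs)
    case (Cons b cs)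
    then show ?case
      by (cases b) (auto intro!: continuous_intros eval)
  qed simp
  have "continuous_on UNIV (\<lambda>G :: 'a \<times> 'a \<Rightarrow> complex. pairing (lincomb (\<lambda>x y. G (x, y)) cs) ds)"
    for cs ds
  proof (induction ds)
    case (Cons b ds)
    then show ?case
      by (cases b) (auto intro!: continuous_intros lin)
  qed simp
  then have "closed {G :: 'a \<times> 'a \<Rightarrow> complex. 0 \<le> pairing (lincomb (\<lambda>x y. G (x, y)) cs) cs}" for cs
    unfolding less_eq_complex_def
    by (intro closed_Collect_conj closed_Collect_le closed_Collect_eq continuous_intros)
  then show ?thesis
    unfolding is_kernel_iff by (rule closed_Collect_all)
qed

text \<open>Where \<open>k x y = 0\<close>, the factor \<open>g x y\<close> is not determined, so the factors on finite sets need
  not fit together. Their diagonals, and hence all their entries, are bounded independently of the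
  finite set, and Tychonoff's theorem selects a common one.\<close>

lemma complete_Pick_pair_factorization:
  fixes k m :: "'a \<Rightarrow> 'a \<Rightarrow> complex"
  assumes Pick: "complete_Pick_pair k m" and diag: "\<And>x. k x x \<noteq> 0"
  shows "\<exists>g. is_kernel g \<and> (\<forall>x y. m x y = k x y * g x y)"
proof -
  define r where "r x = Re (m x x / k x x)" for x
  \<comment> \<open>A positive factor has \<open>g x x = r x\<close>, and \<open>R\<close> is then its Cauchy--Schwarz bound.\<close>
  define R where "R = (\<lambda>(x, y). sqrt (\<bar>r x\<bar> * \<bar>r y\<bar>))"
  define B where "B = {G :: 'a \<times> 'a \<Rightarrow> complex. \<forall>u. \<bar>Re (G u)\<bar> \<le> R u \<and> \<bar>Im (G u)\<bar> \<le> R u}"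
  define C where "C = (\<lambda>(x, y). {G. is_kernel (\<lambda>x y. G (x, y)) \<and> m x y = k x y * G (x, y)})"
  have "B \<inter> (\<Inter>u\<in>UNIV. C u) \<noteq> {}"
  proof (rule compact_imp_fip_image)
    show "compact B"
      unfolding B_def by (rule compact_function_box)
    show "closed (C u)" for u
      unfolding C_def case_prod_unfold
      by (intro closed_Collect_conj closed_kernels closed_Collect_eq continuous_intros
          continuous_on_product_coordinates)
    fix U :: "('a \<times> 'a) set"
    assume "finite U"
    define F where "F = fst ` U \<union> snd ` U"
    have "finite F"
      using \<open>finite U\<close> by (simp add: F_def)
    from finite_factorization[OF Pick diag this] obtain N and w :: "'a \<Rightarrow> nat \<Rightarrow> complex"
      where w: "\<forall>x\<in>F. \<forall>y\<in>F. m x y = k x y * (\<Sum>p<N. w x p * cnj (w y p))"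
      by blast
    \<comment> \<open>Cutting off outside \<open>F\<close> keeps the factor positive and puts it into the compact set \<open>B\<close>.\<close>
    define v where "v x p = (if x \<in> F then w x p else 0)" for x p
    define G where "G = (\<lambda>(x, y). \<Sum>p<N. v x p * cnj (v y p))"
    have G: "m x y = k x y * G (x, y)" if "x \<in> F" "y \<in> F" for x y
      using w that by (simp add: G_def v_def)
    have ker: "is_kernel (\<lambda>x y. G (x, y))"
      unfolding G_def prod.case by (rule is_kernel_gram)
    then interpret G: psd_kernel "\<lambda>x y. G (x, y)"
      by unfold_locales
    have diag_G: "0 \<le> Re (G (x, x))" "Re (G (x, x)) \<le> \<bar>r x\<bar>" for x
    proof -
      show "0 \<le> Re (G (x, x))"
        using G.diag_nonneg[of x] by (simp add: less_eq_complex_def)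
      show "Re (G (x, x)) \<le> \<bar>r x\<bar>"
      proof (cases "x \<in> F")
        case True
        then have "m x x / k x x = G (x, x)"
          using G[OF True True] diag[of x] by simp
        then show ?thesis
          by (simp add: r_def)
      qed (simp add: G_def v_def)
    qed
    have "cmod (G u) \<le> R u" for u
    proof -
      obtain x y where u: "u = (x, y)"
        by (cases u)
      have "(cmod (G (x, y)))\<^sup>2 \<le> Re (G (x, x)) * Re (G (y, y))"
        by (rule G.kernel_Cauchy_Schwarz)
      also have "\<dots> \<le> \<bar>r x\<bar> * \<bar>r y\<bar>"
        by (intro mult_mono diag_G) simp
      finally show ?thesis
        unfolding u R_def prod.case by (rule real_le_rsqrt)
    qed
    then have "G \<in> B"
      unfolding B_def using abs_Re_le_cmod abs_Im_le_cmod order_trans by blast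
    moreover have "G \<in> C u" if "u \<in> U" for u
      using that ker G[of "fst u" "snd u"] by (auto simp: C_def F_def case_prod_unfold)
    ultimately show "B \<inter> (\<Inter>u\<in>U. C u) \<noteq> {}"
      by blast
  qed
  then obtain G where "\<And>u. G \<in> C u"
    by blast
  then have "is_kernel (\<lambda>x y. G (x, y)) \<and> (\<forall>x y. m x y = k x y * G (x, y))"
    by (fastforce simp: C_def)
  then show ?thesis
    by blast
qed

theorem theorem1p10:
  fixes k l :: "'a \<Rightarrow> 'a \<Rightarrow> complex" and Y :: "'a set"
  assumes "\<And>x. k x x \<noteq> 0" and "\<And>x. l x x \<noteq> 0"
    and "complete_Pick_pair k l"
    and "finite Y" and "Y \<noteq> {}"
  shows "complete_Pick_pair k (vanishing_kernel l Y) \<and>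
    (\<exists>g. is_kernel g \<and> (\<forall>x y. vanishing_kernel l Y x y = k x y * g x y))"
proof -
  have "complete_Pick_pair k (vanishing_kernel l Y)"
    by (rule complete_Pick_pair_vanishing_kernel[OF assms(3,4)])
  with complete_Pick_pair_factorization[OF this assms(1)] show ?thesis
    by blast
qed

end
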